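(* Let $p$ be an odd prime and let $f=\sum_{i=0}^{p}a_iX^i$ be an Eisenstein polynomial of degree $p$ over $\mathbb{Q}_p$. For each $i$ with $a_i\neq0$ put $s_i=v_p(a_i)$ and $u_i=a_i/p^{s_i}\in\mathbb{Z}_p^\times$. For $w\in\mathbb{Z}_p$ with $w\not\equiv0\pmod{p^n}$ ($n\in\mathbb{Z}_{\ge1}$), let $\langle w \bmod p^n\rangle$ denote the integer $j$ with $w\equiv j\pmod{p^n}$ and $1\le j\le p^n-1$. Put $$u=\langle u_0^{-1}\bmod p\rangle,\quad a_0'=u^pa_0,\quad a_0''=a_0\{1+(u_0^{-1}u_1)^pa_0\},$$ and, when $f$ is of type $\langle\lambda\rangle$ with $1\le\lambda\le p-1$, $u'_\lambda=u^{p-\lambda}u_\lambda$ and $a'_\lambda=u'_\lambda p$. Then: (i) If $f$ is of type $\langle\lambda\rangle$ ($1\le\lambda\le p-1$), then $f\sim X^p+\langle a'_\lambda\bmod p^2\rangle X^\lambda+p$ if $\lambda\neq p-1$ or $u'_\lambda\not\equiv-1\pmod p$, and $f\sim X^p-pX^{p-1}+\langle a'_0\bmod p^3\rangle$ if $\lambda=p-1$ and $u'_\lambda\equiv-1\pmod p$. (ii) If $f$ is of type $\langle0\rangle$, then $f\sim X^p+\langle a'_0\bmod p^3\rangle$ if $v_p(a_1)\neq2$, and $f\sim X^p+\langle a''_0\bmod p^3\rangle$ if $v_p(a_1)=2$.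
   Context: $v_p$ is the $p$-adic valuation with $v_p(p)=1$. An Eisenstein polynomial of degree $p$ over $\mathbb{Q}_p$ is a monic $f=X^p+a_{p-1}X^{p-1}+\dots+a_0\in\mathbb{Z}_p[X]$ with $v_p(a_i)\ge1$ for all $i$ and $v_p(a_0)=1$. For two such polynomials, $f\sim g$ means $\mathbb{Q}_p[X]/(f)$ and $\mathbb{Q}_p[X]/(g)$ are $\mathbb{Q}_p$-isomorphic. Type: $f$ is of type $\langle0\rangle$ if $v_p(a_i)\ge2$ for all $1\le i\le p-1$; otherwise $f$ is of type $\langle\lambda\rangle$ where $\lambda=\min\{1\le i\le p-1: v_p(a_i)=1\}$. *)

theory Defs
  imports
    "HOL-Library.Extended_Real"
    "HOL-Computational_Algebra.Computational_Algebra"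
    "HOL-Algebra.Algebraic_Closure_Type"
    "Berlekamp_Zassenhaus.Finite_Field"
begin

text \<open>
  The prime is carried by a type: \<open>'p\<close> has class \<open>prime_card\<close>, i.e. \<open>CARD('p)\<close> is prime.
  The \<open>p\<close>-adic integers are the inverse limit of the rings of integers modulo \<open>p ^ n\<close>, an
  element being the sequence of its least nonnegative residues.
\<close>

typedef (overloaded) 'p padic_int =
  "{x :: nat \<Rightarrow> int. \<forall>n. x n \<in> {0..<int CARD('p::prime_card) ^ n} \<and>
      x (Suc n) mod int CARD('p) ^ n = x n}"
  using prime_gt_0_nat[OF prime_card[where 'a = 'p]]
  by (intro exI[of _ "\<lambda>_. 0"]) simp

setup_lifting type_definition_padic_int

lemma CARD_gt_1: "int CARD('p::prime_card) > 1"
  using prime_card_int[where 'a = 'p] by (rule prime_gt_1_int)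

lemma pow_pos: "int CARD('p::prime_card) ^ n > 0"
  using CARD_gt_1[where 'p = 'p] by simp

lemma mod_pow_coherent:
  "(x mod int CARD('p::prime_card) ^ Suc n) mod int CARD('p) ^ n = x mod int CARD('p) ^ n"
  by (rule mod_mod_cancel) simp

lemma coherent_mod:
  assumes "[x (Suc n) = x n] (mod int CARD('p::prime_card) ^ n)"
  shows "x n mod int CARD('p) ^ n \<in> {0..<int CARD('p) ^ n} \<and>
    x (Suc n) mod int CARD('p) ^ Suc n mod int CARD('p) ^ n = x n mod int CARD('p) ^ n"
  using assms pow_pos[where 'p = 'p] mod_pow_coherent[where 'p = 'p]
  by (simp add: cong_def del: power_Suc)

lemma padic_int_of_coherent:
  assumes "\<And>n. [x (Suc n) = x n] (mod int CARD('p::prime_card) ^ n)"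
  shows "(\<lambda>n. x n mod int CARD('p) ^ n) \<in>
    {x :: nat \<Rightarrow> int. \<forall>n. x n \<in> {0..<int CARD('p) ^ n} \<and>
      x (Suc n) mod int CARD('p) ^ n = x n}"
  using coherent_mod[where 'p = 'p, OF assms] by blast

instantiation padic_int :: (prime_card) comm_ring_1
begin

lift_definition zero_padic_int :: "'a padic_int" is "\<lambda>_. 0"
  using pow_pos[where 'p = 'a] by simp

lift_definition one_padic_int :: "'a padic_int" is "\<lambda>n. 1 mod int CARD('a) ^ n"
  by (rule coherent_mod) simp

lift_definition plus_padic_int :: "'a padic_int \<Rightarrow> 'a padic_int \<Rightarrow> 'a padic_int"
  is "\<lambda>x y n. (x n + y n) mod int CARD('a) ^ n"
  by (rule coherent_mod) (rule cong_add; simp add: cong_def)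

lift_definition uminus_padic_int :: "'a padic_int \<Rightarrow> 'a padic_int"
  is "\<lambda>x n. (- x n) mod int CARD('a) ^ n"
  by (rule coherent_mod) (subst cong_minus_minus_iff; simp add: cong_def)

lift_definition minus_padic_int :: "'a padic_int \<Rightarrow> 'a padic_int \<Rightarrow> 'a padic_int"
  is "\<lambda>x y n. (x n - y n) mod int CARD('a) ^ n"
  by (rule coherent_mod) (rule cong_diff; simp add: cong_def)

lift_definition times_padic_int :: "'a padic_int \<Rightarrow> 'a padic_int \<Rightarrow> 'a padic_int"
  is "\<lambda>x y n. (x n * y n) mod int CARD('a) ^ n"
  by (rule coherent_mod) (rule cong_mult; simp add: cong_def)

instance
proof
  fix a b c :: "'a padic_int"
  show "a * b * c = a * (b * c)"
    by transfer (simp add: mod_mult_left_eq mod_mult_right_eq mult.assoc)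
  show "a * b = b * a"
    by transfer (simp add: mult.commute)
  show "1 * a = a"
    by transfer (simp add: mod_mult_left_eq fun_eq_iff)
  show "a + b + c = a + (b + c)"
    by transfer (simp add: mod_add_left_eq mod_add_right_eq add.assoc)
  show "a + b = b + a"
    by transfer (simp add: add.commute)
  show "0 + a = a"
    by transfer (simp add: fun_eq_iff)
  show "- a + a = 0"
    by transfer (simp add: mod_add_left_eq)
  show "a - b = a + - b"
    by transfer (simp add: mod_add_right_eq)
  show "(a + b) * c = a * c + b * c"
    by transfer (simp add: mod_mult_left_eq mod_add_left_eq mod_add_right_eq distrib_right)
  show "(0 :: 'a padic_int) \<noteq> 1"
  proof
    assume "(0 :: 'a padic_int) = 1"
    then have "Rep_padic_int (0 :: 'a padic_int) 1 = Rep_padic_int 1 1" by simp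
    then show False
      using CARD_gt_1[where 'p = 'a] by (simp add: zero_padic_int.rep_eq one_padic_int.rep_eq)
  qed
qed

end

lemma Rep_padic_int_bounds:
  "0 \<le> Rep_padic_int (x :: 'p::prime_card padic_int) n"
  "Rep_padic_int x n < int CARD('p) ^ n"
  using Rep_padic_int[of x] by auto

lemma Rep_padic_int_mod:
  fixes x :: "'p::prime_card padic_int"
  assumes "n \<le> m"
  shows "Rep_padic_int x m mod int CARD('p) ^ n = Rep_padic_int x n"
  using assms
proof (induction m rule: dec_induct)
  case base
  show ?case using Rep_padic_int_bounds[of x n] by simp
next
  case (step k)
  have "Rep_padic_int x (Suc k) mod int CARD('p) ^ n
      = (Rep_padic_int x (Suc k) mod int CARD('p) ^ k) mod int CARD('p) ^ n"
    using step(1) by (simp add: mod_mod_cancel le_imp_power_dvd)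
  also have "Rep_padic_int x (Suc k) mod int CARD('p) ^ k = Rep_padic_int x k"
    using Rep_padic_int[of x] by auto
  finally show ?case using step by simp
qed

lemma Rep_padic_int_eq_0_iff:
  fixes x :: "'p::prime_card padic_int"
  assumes "n \<le> m"
  shows "Rep_padic_int x n = 0 \<longleftrightarrow> int CARD('p) ^ n dvd Rep_padic_int x m"
  using Rep_padic_int_mod[OF assms, of x] by (metis mod_0_imp_dvd dvd_imp_mod_0)

lemma padic_int_nonzero_index:
  assumes "(x :: 'p::prime_card padic_int) \<noteq> 0"
  obtains m where "Rep_padic_int x m \<noteq> 0"
  using assms that by (metis Rep_padic_int_inject zero_padic_int.rep_eq ext)

instance padic_int :: (prime_card) idom
proof
  fix a b :: "'a padic_int"
  assume "a \<noteq> 0" "b \<noteq> 0"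
  then obtain m n where m: "Rep_padic_int a m \<noteq> 0" and n: "Rep_padic_int b n \<noteq> 0"
    by (metis padic_int_nonzero_index)
  show "a * b \<noteq> 0"
  proof
    assume "a * b = 0"
    then have "Rep_padic_int (a * b) (m + n) = Rep_padic_int (0 :: 'a padic_int) (m + n)" by simp
    then have "int CARD('a) ^ (m + n) dvd Rep_padic_int a (m + n) * Rep_padic_int b (m + n)"
      by (simp add: zero_padic_int.rep_eq times_padic_int.rep_eq mod_0_imp_dvd)
    then obtain i j where ij: "i + j = m + n" "int CARD('a) ^ i dvd Rep_padic_int a (m + n)"
        "int CARD('a) ^ j dvd Rep_padic_int b (m + n)"
      using prime_elem_power_dvd_prod prime_card_int[where 'a = 'a] by blast
    then have "m \<le> i \<or> n \<le> j" by linarith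
    then show False
      using ij m n Rep_padic_int_eq_0_iff[of m "m + n" a] Rep_padic_int_eq_0_iff[of n "m + n" b]
      by (auto dest: power_le_dvd)
  qed
qed

type_synonym 'p padic = "'p padic_int fract"

definition Zp :: "'p::prime_card padic set" where
  "Zp = range to_fract"

abbreviation padic_p :: "'p::prime_card padic" where
  "padic_p \<equiv> of_nat CARD('p)"

text \<open>
  For \<open>x \<noteq> 0\<close>, \<open>padic_ord x\<close> is the exponent \<open>k\<close> in \<open>x = p ^ k * w\<close> with \<open>w\<close> a unit of the
  \<open>p\<close>-adic integers; see \<open>padic_decomp\<close> and \<open>padic_ord_eq\<close> for existence and uniqueness.
\<close>

definition padic_ord :: "'p::prime_card padic \<Rightarrow> int" where
  "padic_ord x = (THE k. \<exists>w. w dvd 1 \<and> x = padic_p powi k * to_fract w)"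

definition vp :: "'p::prime_card padic \<Rightarrow> ereal" where
  "vp x = (if x = 0 then \<infinity> else ereal (of_int (padic_ord x)))"

definition padic_cong :: "nat \<Rightarrow> 'p::prime_card padic \<Rightarrow> 'p padic \<Rightarrow> bool" where
  "padic_cong n x y \<longleftrightarrow> (\<exists>z\<in>Zp. x - y = padic_p ^ n * z)"

text \<open>Only meaningful for \<open>w \<in> Zp\<close> with \<open>w\<close> not congruent to \<open>0\<close>; see \<open>residue_ex1\<close>.\<close>

definition residue :: "nat \<Rightarrow> 'p::prime_card padic \<Rightarrow> int" where
  "residue n w = (THE j. 1 \<le> j \<and> j \<le> int CARD('p) ^ n - 1 \<and> padic_cong n w (of_int j))"

definition eisenstein :: "'p::prime_card padic poly \<Rightarrow> bool" where
  "eisenstein f \<longleftrightarrow> degree f = CARD('p) \<and> lead_coeff f = 1 \<and> (\<forall>i. coeff f i \<in> Zp) \<and>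
     (\<forall>i<CARD('p). vp (coeff f i) \<ge> 1) \<and> vp (coeff f 0) = 1"

definition eisenstein_type :: "'p::prime_card padic poly \<Rightarrow> nat" where
  "eisenstein_type f =
     (if \<forall>i\<in>{1..CARD('p) - 1}. vp (coeff f i) \<ge> 2 then 0
      else Min {i \<in> {1..CARD('p) - 1}. vp (coeff f i) = 1})"

text \<open>
  \<open>ring_of_type_algebra\<close> is the polynomial ring as a HOL-Algebra structure. The condition on
  constants makes \<open>\<phi>\<close> linear over the base field, which sits in the quotients as the cosets
  of constant polynomials.
\<close>

abbreviation poly_quot :: "'a::field poly \<Rightarrow> 'a poly set ring" where
  "poly_quot f \<equiv> ring_of_type_algebra Quot (PIdl\<^bsub>ring_of_type_algebra\<^esub> f)"

abbreviation poly_class :: "'a::field poly \<Rightarrow> 'a poly \<Rightarrow> 'a poly set" where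
  "poly_class f q \<equiv> PIdl\<^bsub>ring_of_type_algebra\<^esub> f +>\<^bsub>ring_of_type_algebra\<^esub> q"

definition quot_equiv :: "'a::field poly \<Rightarrow> 'a poly \<Rightarrow> bool" (infix \<open>\<sim>\<^sub>Q\<close> 50) where
  "f \<sim>\<^sub>Q g \<longleftrightarrow> (\<exists>\<phi> \<in> ring_iso (poly_quot f) (poly_quot g).
      \<forall>c. \<phi> (poly_class f [:c:]) = poly_class g [:c:])"

subsection \<open>Well-definedness\<close>

lemma Rep_padic_int_of_int:
  "Rep_padic_int (of_int k :: 'p::prime_card padic_int) n = k mod int CARD('p) ^ n"
proof -
  have nat: "Rep_padic_int (of_nat m :: 'p padic_int) n = int m mod int CARD('p) ^ n" for m
    by (induction m)
      (simp_all add: zero_padic_int.rep_eq one_padic_int.rep_eq plus_padic_int.rep_eq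
         mod_add_left_eq mod_add_right_eq)
  show ?thesis
    by (cases k rule: int_cases2)
      (simp_all add: nat uminus_padic_int.rep_eq mod_minus_eq)
qed

lemma padic_int_dvd_pow_iff:
  fixes x :: "'p::prime_card padic_int"
  shows "of_nat CARD('p) ^ n dvd x \<longleftrightarrow> Rep_padic_int x n = 0"
proof
  assume "of_nat CARD('p) ^ n dvd x"
  then obtain y where "x = of_int (int CARD('p) ^ n) * y" by (auto simp: dvd_def)
  then show "Rep_padic_int x n = 0"
    by (simp only: times_padic_int.rep_eq Rep_padic_int_of_int) simp
next
  assume x: "Rep_padic_int x n = 0"
  let ?p = "int CARD('p)"
  define y where "y = (\<lambda>k. Rep_padic_int x (n + k) div ?p ^ n)"
  have y: "Rep_padic_int x (n + k) = ?p ^ n * y k" for k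
    using x Rep_padic_int_eq_0_iff[of n "n + k" x] by (simp add: y_def)
  have "[y (Suc k) = y k] (mod ?p ^ k)" for k
  proof -
    have "[?p ^ n * y (Suc k) = ?p ^ n * y k] (mod ?p ^ n * ?p ^ k)"
      using Rep_padic_int_mod[of "n + k" "n + Suc k" x] Rep_padic_int_mod[of "n + k" "n + k" x]
      by (simp add: y[symmetric] cong_def power_add)
    then show ?thesis
      using CARD_gt_1[where 'p = 'p] by (simp add: cong_iff_dvd_diff right_diff_distrib[symmetric])
  qed
  note coh = padic_int_of_coherent[where 'p = 'p, OF this]
  define z :: "'p padic_int" where "z = Abs_padic_int (\<lambda>k. y k mod ?p ^ k)"
  have z: "Rep_padic_int z k = y k mod ?p ^ k" for k
    by (simp add: z_def Abs_padic_int_inverse[OF coh])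
  have "Rep_padic_int x k = Rep_padic_int (of_int (?p ^ n) * z) k" for k
  proof -
    have "Rep_padic_int x k = Rep_padic_int x (n + k) mod ?p ^ k"
      by (simp add: Rep_padic_int_mod)
    also have "\<dots> = Rep_padic_int (of_int (?p ^ n) * z) k"
      by (simp only: y times_padic_int.rep_eq Rep_padic_int_of_int z)
        (simp add: mod_mult_left_eq mod_mult_right_eq)
    finally show ?thesis .
  qed
  then have "x = of_int (?p ^ n) * z"
    by (simp add: Rep_padic_int_inject[symmetric] fun_eq_iff)
  then show "of_nat CARD('p) ^ n dvd x" by simp
qed

lemma padic_int_unit_iff:
  fixes w :: "'p::prime_card padic_int"
  shows "w dvd 1 \<longleftrightarrow> \<not> of_nat CARD('p) dvd w"
proof
  let ?p = "int CARD('p)"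
  assume "w dvd 1"
  then show "\<not> of_nat CARD('p) dvd w"
    using padic_int_dvd_pow_iff[of 1 "1 :: 'p padic_int"] CARD_gt_1[where 'p = 'p]
    by (auto simp: one_padic_int.rep_eq dest: dvd_trans)
next
  let ?p = "int CARD('p)"
  assume "\<not> of_nat CARD('p) dvd w"
  then have w1: "Rep_padic_int w 1 \<noteq> 0" using padic_int_dvd_pow_iff[of 1 w] by simp
  have "\<exists>v. [Rep_padic_int w n * v = 1] (mod ?p ^ n)" for n
  proof (cases n)
    case (Suc k)
    then have "\<not> ?p dvd Rep_padic_int w n"
      using w1 Rep_padic_int_eq_0_iff[of 1 n w] by simp
    then have "coprime (Rep_padic_int w n) (?p ^ n)"
      using prime_card_int[where 'a = 'p]
      by (metis coprime_commute coprime_power_right_iff prime_imp_coprime)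
    then show ?thesis by (rule cong_solve_coprime_int)
  qed simp
  then obtain v where v: "\<And>n. [Rep_padic_int w n * v n = 1] (mod ?p ^ n)" by metis
  have "[v (Suc n) = v n] (mod ?p ^ n)" for n
  proof -
    have 1: "[Rep_padic_int w (Suc n) = Rep_padic_int w n] (mod ?p ^ n)"
      using Rep_padic_int_mod[of n "Suc n" w] Rep_padic_int_mod[of n n w] by (simp add: cong_def)
    have 2: "[Rep_padic_int w (Suc n) * v (Suc n) = 1] (mod ?p ^ n)"
      using v[of "Suc n"] by (rule cong_dvd_modulus) simp
    have 3: "[Rep_padic_int w n * v (Suc n) = 1] (mod ?p ^ n)"
      using cong_scalar_right[OF 1, of "v (Suc n)"] 2 by (metis cong_sym cong_trans)
    have "[v (Suc n) = v (Suc n) * (Rep_padic_int w n * v n)] (mod ?p ^ n)"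
      using cong_scalar_left[OF v[of n], of "v (Suc n)"] by (simp add: cong_sym)
    also have "v (Suc n) * (Rep_padic_int w n * v n) = (Rep_padic_int w n * v (Suc n)) * v n"
      by simp
    also have "[\<dots> = 1 * v n] (mod ?p ^ n)" using 3 by (rule cong_scalar_right)
    finally show ?thesis by simp
  qed
  note coh = padic_int_of_coherent[where 'p = 'p, OF this]
  define z :: "'p padic_int" where "z = Abs_padic_int (\<lambda>k. v k mod ?p ^ k)"
  have z: "Rep_padic_int z k = v k mod ?p ^ k" for k
    by (simp add: z_def Abs_padic_int_inverse[OF coh])
  have "Rep_padic_int (w * z) k = Rep_padic_int (1 :: 'p padic_int) k" for k
    using v[of k] by (simp add: times_padic_int.rep_eq one_padic_int.rep_eq z mod_mult_right_eq cong_def)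
  then have "w * z = 1" by (simp add: Rep_padic_int_inject[symmetric] fun_eq_iff)
  then show "w dvd 1" by (metis dvd_triv_left)
qed

lemma padic_p_nonzero: "(of_nat CARD('p) :: 'p::prime_card padic_int) \<noteq> 0"
proof
  assume "(of_nat CARD('p) :: 'p padic_int) = 0"
  then have "(of_nat CARD('p) :: 'p padic_int) ^ 2 dvd of_nat CARD('p)" by simp
  then have "Rep_padic_int (of_int (int CARD('p)) :: 'p padic_int) 2 = 0"
    by (subst (asm) padic_int_dvd_pow_iff) simp
  then show False
    using CARD_gt_1[where 'p = 'p]
    by (simp only: Rep_padic_int_of_int) (simp add: power2_eq_square)
qed

lemma padic_p_eq_to_fract: "(padic_p :: 'p::prime_card padic) = to_fract (of_nat CARD('p))"
  by (simp add: to_fract_def of_nat_fract)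

lemma to_fract_power: "to_fract (x ^ n) = to_fract x ^ n"
  by (induction n) simp_all

lemma padic_p_neq_0 [simp]: "(padic_p :: 'p::prime_card padic) \<noteq> 0"
  using padic_p_nonzero[where 'p = 'p] by (simp only: padic_p_eq_to_fract) simp

lemma padic_int_decomp:
  fixes x :: "'p::prime_card padic_int"
  assumes "x \<noteq> 0"
  obtains n w where "w dvd 1" "x = of_nat CARD('p) ^ n * w"
proof -
  obtain m where m: "Rep_padic_int x m \<noteq> 0"
    using assms by (rule padic_int_nonzero_index)
  define S where "S = {n. of_nat CARD('p) ^ n dvd x}"
  have bd: "n < m" if "n \<in> S" for n
    using that m padic_int_dvd_pow_iff[of m x] by (auto simp: S_def not_le[symmetric] dest: power_le_dvd)
  have "S \<noteq> {}" by (auto simp: S_def intro: exI[of _ 0])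
  moreover have "finite S" using bd by (auto intro: finite_subset[of _ "{..<m}"])
  ultimately have max: "Max S \<in> S" "Suc (Max S) \<notin> S"
    by (auto dest: Max_ge)
  from max(1) obtain w where w: "x = of_nat CARD('p) ^ Max S * w" by (auto simp: S_def dvd_def)
  have "\<not> of_nat CARD('p) dvd w"
  proof
    assume "of_nat CARD('p) dvd w"
    then have "of_nat CARD('p) ^ Max S * of_nat CARD('p) dvd x"
      unfolding w by (rule mult_dvd_mono[OF dvd_refl])
    then show False using max(2) by (simp add: S_def mult.commute)
  qed
  then show ?thesis using that w padic_int_unit_iff by blast
qed

lemma padic_decomp:
  fixes x :: "'p::prime_card padic"
  assumes "x \<noteq> 0"
  obtains k w where "w dvd 1" "x = padic_p powi k * to_fract w"
proof -
  obtain a b where ab: "x = Fraction_Field.Fract a b" "b \<noteq> 0" "a \<noteq> 0"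
    using assms by (cases x rule: Fract_cases_nonzero) auto
  obtain m u where u: "u dvd 1" "a = of_nat CARD('p) ^ m * u" using padic_int_decomp ab(3) .
  obtain n v where v: "v dvd 1" "b = of_nat CARD('p) ^ n * v" using padic_int_decomp ab(2) .
  obtain v' where v': "v * v' = 1" using v(1) by (auto simp: dvd_def)
  have "to_fract v * to_fract v' = 1" using v' by (metis to_fract_1 to_fract_mult)
  then have inv: "inverse (to_fract v) = to_fract v'" by (rule inverse_unique)
  have "x = to_fract a / to_fract b" using ab by (simp add: to_fract_def)
  also have "\<dots> = (padic_p ^ m / padic_p ^ n) * (to_fract u * inverse (to_fract v))"
    by (simp add: u v to_fract_mult to_fract_power padic_p_eq_to_fract divide_inverse inverse_mult_distrib)
  also have "\<dots> = padic_p powi (int m - int n) * to_fract (u * v')"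
    by (simp add: inv power_int_diff)
  finally show ?thesis
    using that[of "u * v'" "int m - int n"] u(1) v' by (metis dvd_triv_right is_unit_mult_iff)
qed

lemma padic_decomp_unique:
  fixes w w' :: "'p::prime_card padic_int"
  assumes "w dvd 1" "w' dvd 1" "padic_p powi k * to_fract w = padic_p powi k' * to_fract w'"
  shows "k = k'"
proof -
  have *: "\<not> k < k'" if w: "w dvd 1" and eq: "padic_p powi k * to_fract w = padic_p powi k' * to_fract w'"
    for k k' and w w' :: "'p padic_int"
  proof
    assume "k < k'"
    then obtain n where n: "k' = k + int (Suc n)" by (metis zless_iff_Suc_zadd)
    have "to_fract w = padic_p ^ Suc n * to_fract w'"
      using eq by (simp add: n power_int_add del: of_nat_Suc power_Suc)
    then have "to_fract w = to_fract (of_nat CARD('p) ^ Suc n * w')"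
      by (simp add: padic_p_eq_to_fract to_fract_power)
    then have "of_nat CARD('p) dvd w" by (simp only: to_fract_eq_iff) simp
    then show False using w padic_int_unit_iff by blast
  qed
  show ?thesis using *[OF assms(1,3)] *[OF assms(2) assms(3)[symmetric]] by linarith
qed

lemma padic_ord_eq:
  assumes "w dvd 1"
  shows "padic_ord (padic_p powi k * to_fract w) = k"
  unfolding padic_ord_def
proof (rule the_equality)
  show "\<exists>w'. w' dvd 1 \<and> padic_p powi k * to_fract w = padic_p powi k * to_fract w'"
    using assms by blast
next
  fix k' assume "\<exists>w'. w' dvd 1 \<and> padic_p powi k * to_fract w = padic_p powi k' * to_fract w'"
  then obtain w' where "w' dvd 1" "padic_p powi k * to_fract w = padic_p powi k' * to_fract w'" by blast
  then show "k' = k" using padic_decomp_unique[OF assms, of w' k k'] by simp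
qed

lemma vp_padic_p: "vp (padic_p :: 'p::prime_card padic) = 1"
  using padic_ord_eq[of "1 :: 'p padic_int" 1] by (simp add: vp_def)

lemma residue_ex1:
  fixes w :: "'p::prime_card padic"
  assumes "w \<in> Zp" "\<not> padic_cong n w 0"
  shows "\<exists>!j. 1 \<le> j \<and> j \<le> int CARD('p) ^ n - 1 \<and> padic_cong n w (of_int j)"
proof -
  obtain x where x: "w = to_fract x" using assms(1) by (auto simp: Zp_def)
  have of_int: "of_int j = to_fract (of_int j :: 'p padic_int)" for j
    by (cases j rule: int_cases2) (simp_all add: to_fract_def of_nat_fract)
  have cong: "padic_cong n w (of_int j) \<longleftrightarrow> Rep_padic_int x n = j mod int CARD('p) ^ n" for j
  proof -
    have "padic_cong n w (of_int j) \<longleftrightarrow>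
        (\<exists>z. to_fract (x - of_int j) = to_fract (of_nat CARD('p) ^ n * z))"
      by (simp add: padic_cong_def Zp_def x of_int padic_p_eq_to_fract to_fract_power)
    also have "\<dots> \<longleftrightarrow> of_nat CARD('p) ^ n dvd x - of_int j"
      by (simp only: to_fract_eq_iff dvd_def)
    also have "\<dots> \<longleftrightarrow> (Rep_padic_int x n - j mod int CARD('p) ^ n) mod int CARD('p) ^ n = 0"
      by (simp add: padic_int_dvd_pow_iff minus_padic_int.rep_eq Rep_padic_int_of_int)
    also have "\<dots> \<longleftrightarrow> Rep_padic_int x n = j mod int CARD('p) ^ n"
      using Rep_padic_int_mod[of n n x] by (simp add: mod_eq_dvd_iff[symmetric] mod_eq_0_iff_dvd)
    finally show ?thesis .
  qed
  have "Rep_padic_int x n \<noteq> 0" using assms(2) cong[of 0] by simp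
  then show ?thesis
    using Rep_padic_int_bounds[of x n] by (intro ex1I[of _ "Rep_padic_int x n"]) (auto simp: cong)
qed

end

theory Submission
  imports Defs
begin

text \<open>
  Let \<open>A\<close> be the ring of polynomials over the \<open>p\<close>-adic integers, \<open>F \<in> A\<close> an Eisenstein polynomial and
  \<open>I n\<close> the ideal of \<open>A\<close> generated by \<open>F\<close> and \<open>X ^ n\<close>. Then \<open>p \<in> I p\<close>, so \<open>I n\<close> plays the role of the
  \<open>n\<close>-th power of the maximal ideal of \<open>A / (F)\<close>, whose uniformizer is the class of \<open>X\<close>. If \<open>G\<close> has the same
  degree as \<open>F\<close>, then \<open>F \<sim>\<^sub>Q G\<close> as soon as \<open>G\<close> has a root \<open>R\<close> modulo \<open>F\<close> with \<open>R - X \<in> I 2\<close>. Such a root is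
  found by Newton approximation: with \<open>G = X ^ p + p c X ^ l + p d\<close>, adding \<open>X ^ (m + 1) s\<close> to a
  polynomial \<open>Y\<close> congruent to \<open>X\<close> modulo \<open>X ^ 2\<close> changes \<open>G(Y)\<close> by \<open>l c s p X ^ (l + m)\<close> up to higher order
  as soon as \<open>l + m < p m\<close>, hence any starting value with \<open>G(Y)\<close> of order at least \<open>p + l + m\<close> can be
  corrected. For type \<open>l < p - 1\<close> one starts at \<open>Y = X\<close>, \<open>m = 1\<close>. For \<open>l = p - 1\<close> one needs \<open>m = 2\<close> and
  \<open>Y = X + t X ^ 2\<close>, where \<open>t\<close> solves a congruence \<open>e + t ^ p + c t = 0\<close> modulo \<open>p\<close>, which is
  always solvable unless \<open>c = -1\<close>. For type \<open>0\<close> the term \<open>X ^ p\<close> takes over the role of \<open>p c X ^ l\<close>, and one starts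
  at \<open>X + y X ^ 2\<close> with \<open>y = - a\<^sub>1 / (p a\<^sub>0)\<close>, which removes the linear term of \<open>F\<close> and contributes \<open>y ^ p X ^ (2 p)\<close>.
\<close>

subsection \<open>Quotients of polynomial rings over a field\<close>

lemma carrier_ring_of_type_algebra [simp]: "carrier (ring_of_type_algebra :: 'a::comm_ring_1 ring) = UNIV"
  and mult_ring_of_type_algebra [simp]: "monoid.mult (ring_of_type_algebra :: 'a ring) = (*)"
  and add_ring_of_type_algebra [simp]: "ring.add (ring_of_type_algebra :: 'a ring) = (+)"
  and one_ring_of_type_algebra [simp]: "monoid.one (ring_of_type_algebra :: 'a ring) = 1"
  and zero_ring_of_type_algebra [simp]: "ring.zero (ring_of_type_algebra :: 'a ring) = 0"
  by (simp_all add: ring_of_type_algebra_def fun_eq_iff)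

lemma PIdl_eq: "PIdl\<^bsub>ring_of_type_algebra\<^esub> f = {q. f dvd q}" for f :: "'a::comm_ring_1"
  by (auto simp: cgenideal_def dvd_def mult.commute)

lemma ideal_PIdl: "ideal (PIdl\<^bsub>ring_of_type_algebra\<^esub> f) ring_of_type_algebra" for f :: "'a::comm_ring_1"
  by (rule cring.cgenideal_ideal[OF cring_from_type_algebra]) simp

lemma poly_class_conv: "poly_class f q = {h. f dvd h - q}" for f :: "'a::field poly"
proof -
  have "h \<in> poly_class f q \<longleftrightarrow> (\<exists>g. f dvd g \<and> h = g + q)" for h
    unfolding a_r_coset_def' PIdl_eq by auto
  also have "\<dots> h \<longleftrightarrow> f dvd h - q" for h
    by (metis add_diff_cancel_right' diff_add_cancel)
  finally show ?thesis by blast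
qed

lemma poly_class_eq_iff: "poly_class f q = poly_class f r \<longleftrightarrow> f dvd q - r" for f :: "'a::field poly"
proof
  assume "poly_class f q = poly_class f r"
  moreover have "q \<in> poly_class f q" by (simp add: poly_class_conv)
  ultimately show "f dvd q - r" by (simp add: poly_class_conv)
next
  assume "f dvd q - r"
  then have "f dvd h - q \<longleftrightarrow> f dvd h - r" for h
    using dvd_add_left_iff[of f "q - r" "h - q"] by simp
  then show "poly_class f q = poly_class f r" by (simp add: poly_class_conv)
qed

lemma carrier_poly_quot: "carrier (poly_quot f) = range (poly_class f)" for f :: "'a::field poly"
  by (auto simp: FactRing_def A_RCOSETS_def')

lemma quot_equiv_sym:
  fixes f g :: "'a::field poly"
  assumes "f \<sim>\<^sub>Q g"
  shows "g \<sim>\<^sub>Q f"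
proof -
  obtain \<phi> where \<phi>: "\<phi> \<in> ring_iso (poly_quot f) (poly_quot g)"
      "\<And>c. \<phi> (poly_class f [:c:]) = poly_class g [:c:]"
    using assms by (auto simp: quot_equiv_def)
  have "inj_on \<phi> (carrier (poly_quot f))"
    using \<phi>(1) by (auto simp: ring_iso_def bij_betw_def)
  then have "inv_into (carrier (poly_quot f)) \<phi> (poly_class g [:c:]) = poly_class f [:c:]" for c
    unfolding \<phi>(2)[symmetric] by (rule inv_into_f_f) (simp add: carrier_poly_quot)
  moreover have "ring (poly_quot f)"
    by (rule ideal.quotient_is_ring[OF ideal_PIdl])
  ultimately show ?thesis
    using ring_iso_set_sym[OF _ \<phi>(1)] by (auto simp: quot_equiv_def)
qed

lemma quot_equiv_trans:
  fixes f g h :: "'a::field poly"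
  assumes "f \<sim>\<^sub>Q g" "g \<sim>\<^sub>Q h"
  shows "f \<sim>\<^sub>Q h"
proof -
  obtain \<phi> \<psi> where "\<phi> \<in> ring_iso (poly_quot f) (poly_quot g)"
      "\<And>c. \<phi> (poly_class f [:c:]) = poly_class g [:c:]"
      "\<psi> \<in> ring_iso (poly_quot g) (poly_quot h)"
      "\<And>c. \<psi> (poly_class g [:c:]) = poly_class h [:c:]"
    using assms by (auto simp: quot_equiv_def)
  then show ?thesis
    unfolding quot_equiv_def by (intro bexI[of _ "\<psi> \<circ> \<phi>"]) (auto intro: ring_iso_set_trans)
qed

text \<open>First isomorphism theorem for the map sending \<open>q\<close> to the class of
  \<open>pcompose q r\<close>: the first hypothesis identifies its kernel with the ideal of
  \<open>g\<close>, the second makes it onto. The isomorphism obtained runs from the quotient by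
  \<open>g\<close> to that by \<open>f\<close>, hence the appeal to symmetry.\<close>

lemma quot_equivI_surj:
  fixes f g r :: "'a::field poly"
  assumes dvd: "\<And>q. f dvd pcompose q r \<longleftrightarrow> g dvd q"
    and surj: "\<And>q. \<exists>q'. f dvd pcompose q' r - q"
  shows "f \<sim>\<^sub>Q g"
proof (rule quot_equiv_sym)
  let ?R = "ring_of_type_algebra :: 'a poly ring"
  define h where "h q = poly_class f (pcompose q r)" for q
  interpret P: ring ?R by (rule ring_from_type_algebra)
  interpret I: ideal "PIdl\<^bsub>?R\<^esub> f" ?R by (rule ideal_PIdl)
  interpret Q: ring "poly_quot f" by (rule I.quotient_is_ring)
  have "(\<lambda>q. poly_class f q) \<in> Ring.ring_hom ?R (poly_quot f)"
    using I.rcos_ring_hom by simp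
  then have "h \<in> Ring.ring_hom ?R (poly_quot f)"
    unfolding h_def
    by (auto simp: Ring.ring_hom_def pcompose_mult pcompose_add pcompose_1)
  then interpret H: ring_hom_ring ?R "poly_quot f" h
    by (intro ring_hom_ringI2) (auto intro: ring_from_type_algebra Q.ring_axioms)
  have ker: "a_kernel ?R (poly_quot f) h = PIdl\<^bsub>?R\<^esub> g"
  proof -
    have zero: "\<zero>\<^bsub>poly_quot f\<^esub> = poly_class f 0"
      unfolding poly_class_conv by (simp add: FactRing_def PIdl_eq)
    have "a_kernel ?R (poly_quot f) h = {q. h q = poly_class f 0}"
      unfolding a_kernel_def' zero carrier_ring_of_type_algebra by blast
    also have "\<dots> = PIdl\<^bsub>?R\<^esub> g"
      unfolding h_def poly_class_eq_iff by (simp add: dvd PIdl_eq)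
    finally show ?thesis .
  qed
  have "poly_class f q \<in> range h" for q
  proof -
    obtain q' where "f dvd pcompose q' r - q" using surj by blast
    then have "h q' = poly_class f q" unfolding h_def poly_class_eq_iff .
    then show ?thesis by (metis rangeI)
  qed
  then have "h ` carrier ?R = carrier (poly_quot f)"
    unfolding carrier_poly_quot carrier_ring_of_type_algebra by (auto simp: h_def)
  from H.FactRing_iso_set[OF this]
  have iso: "(\<lambda>A. the_elem (h ` A)) \<in> ring_iso (poly_quot g) (poly_quot f)"
    by (simp add: ker)
  \<comment> \<open>The isomorphism is evaluated on a coset through its image under
    \<open>h\<close>, a singleton because \<open>h\<close> is constant on cosets of its
    kernel.\<close>
  have "the_elem (h ` poly_class g [:c:]) = poly_class f [:c:]" for c
  proof -
    have "h ` poly_class g [:c:] = {h [:c:]}"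
    proof -
      have "h q = h [:c:]" if "q \<in> poly_class g [:c:]" for q
      proof -
        have "f dvd pcompose (q - [:c:]) r"
          using that unfolding poly_class_conv dvd by simp
        then show ?thesis unfolding h_def poly_class_eq_iff by (simp add: pcompose_diff)
      qed
      moreover have "[:c:] \<in> poly_class g [:c:]" by (simp add: poly_class_conv)
      ultimately show ?thesis by blast
    qed
    then show ?thesis by (simp add: h_def)
  qed
  then show "g \<sim>\<^sub>Q f"
    unfolding quot_equiv_def by (intro bexI[OF _ iso] allI)
qed

section \<open>Isomorphic quotients from an injective substitution\<close>

lemma vector_space_smult: "vector_space (smult :: 'a::field \<Rightarrow> 'a poly \<Rightarrow> 'a poly)"
  by unfold_locales (simp_all add: smult_add_right smult_add_left)

text \<open>Injectivity of substituting \<open>r\<close> suffices: both quotients have dimension \<open>n\<close>.\<close>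

lemma quot_equivI:
  fixes f g r :: "'a::field poly"
  assumes deg: "degree f = n" "degree g = n" "0 < n"
    and dvd: "f dvd pcompose g r"
    and inj: "\<And>q. degree q < n \<Longrightarrow> f dvd pcompose q r \<Longrightarrow> q = 0"
  shows "f \<sim>\<^sub>Q g"
proof (rule quot_equivI_surj[where r = r])
  interpret V: vector_space "smult :: 'a \<Rightarrow> 'a poly \<Rightarrow> 'a poly" by (rule vector_space_smult)
  have nz: "f \<noteq> 0" "g \<noteq> 0" using deg by auto
  show "f dvd pcompose q r \<longleftrightarrow> g dvd q" for q
  proof -
    have "pcompose q r = pcompose g r * pcompose (q div g) r + pcompose (q mod g) r"
      by (metis mult_div_mod_eq pcompose_add pcompose_mult)
    then have "f dvd pcompose q r \<longleftrightarrow> f dvd pcompose (q mod g) r"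
      using dvd by (simp add: dvd_add_right_iff)
    also have "\<dots> \<longleftrightarrow> q mod g = 0"
      using inj[of "q mod g"] degree_mod_less[OF nz(2), of q] deg by auto
    finally show ?thesis by (simp add: dvd_eq_mod_eq_0)
  qed
  \<comment> \<open>The monomials in \<open>T\<close> span the polynomials of degree below
    \<open>n\<close>. The remainders \<open>e i\<close> will be \<open>n\<close> independent vectors
    in this span, so a remainder outside their own span would exceed the dimension.\<close>
  define T where "T = (\<lambda>i. monom (1::'a) i) ` {..<n}"
  have spanT: "h \<in> V.span T" if "degree h < n" for h
  proof -
    have "h = (\<Sum>i\<le>degree h. smult (coeff h i) (monom 1 i))"
      by (simp add: poly_as_sum_of_monoms smult_monom)
    also have "\<dots> \<in> V.span T"
      using that by (intro V.span_sum V.span_scale V.span_base) (auto simp: T_def)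
    finally show ?thesis .
  qed
  define e where "e i = pcompose (monom 1 i) r mod f" for i :: nat
  have lin: "(\<Sum>i<n. smult (c i) (e i)) = pcompose (\<Sum>i<n. monom (c i) i) r mod f" for c :: "nat \<Rightarrow> 'a"
  proof -
    have "(\<Sum>i<n. smult (c i) (e i)) = (\<Sum>i<n. pcompose (monom (c i) i) r mod f)"
      by (simp add: e_def mod_smult_left[symmetric] pcompose_smult[symmetric] smult_monom)
    also have "\<dots> = pcompose (\<Sum>i<n. monom (c i) i) r mod f"
      by (induction n) (simp_all add: pcompose_add poly_mod_add_left)
    finally show ?thesis .
  qed
  have zero: "c i = 0" if "(\<Sum>i<n. smult (c i) (e i)) = 0" "i < n" for c i
  proof -
    let ?q = "\<Sum>i<n. monom (c i) i"
    have "degree ?q \<le> n - 1"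
      by (rule degree_sum_le) (auto intro!: order.trans[OF degree_monom_le])
    then have "?q = 0"
      using that(1) lin[of c] deg(3) by (intro inj) (auto simp: dvd_eq_mod_eq_0)
    then have "coeff ?q i = 0" by simp
    then show ?thesis using that(2) by (simp add: coeff_sum)
  qed
  have inj_e: "inj_on e {..<n}"
  proof (rule inj_onI, rule ccontr)
    fix i j assume ij: "i \<in> {..<n}" "j \<in> {..<n}" "e i = e j" "i \<noteq> j"
    \<comment> \<open>These are the coefficients of the relation \<open>e i - e j = 0\<close>, which
      \<open>zero\<close> excludes. Distinctness of the \<open>e i\<close> is needed because
      independence is a property of their image set.\<close>
    let ?c = "\<lambda>k. if k = i then 1 else if k = j then - 1 else 0 :: 'a"
    have "(\<Sum>k<n. smult (?c k) (e k)) = (\<Sum>k\<in>{i,j}. smult (?c k) (e k))"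
      using ij by (intro sum.mono_neutral_right) auto
    also have "\<dots> = 0" using ij by simp
    finally have "?c i = 0" by (rule zero) (use ij in auto)
    then show False by simp
  qed
  have indep: "V.independent (e ` {..<n})"
  proof (rule V.independent_if_scalars_zero)
    fix u x assume u: "(\<Sum>x\<in>e ` {..<n}. smult (u x) x) = 0" "x \<in> e ` {..<n}"
    have "(\<Sum>i<n. smult (u (e i)) (e i)) = 0"
      using u(1) by (simp add: sum.reindex[OF inj_e])
    then show "u x = 0" using zero[of "\<lambda>i. u (e i)"] u(2) by auto
  qed simp
  fix q
  have "q mod f \<in> V.span (e ` {..<n})"
  proof (rule ccontr)
    assume *: "q mod f \<notin> V.span (e ` {..<n})"
    have 1: "degree (h mod f) < n" for h
      using degree_mod_less[OF nz(1), of h] deg by auto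
    have "insert (q mod f) (e ` {..<n}) \<subseteq> V.span T"
      using 1 spanT by (auto simp: e_def)
    moreover have "V.independent (insert (q mod f) (e ` {..<n}))"
      using * indep by (rule V.independent_insertI)
    ultimately have "card (insert (q mod f) (e ` {..<n})) \<le> card T"
      using V.independent_span_bound[of T] by (auto simp: T_def)
    moreover have "card T \<le> n"
      using card_image_le[of "{..<n}" "monom (1::'a)"] by (simp add: T_def)
    moreover have "q mod f \<notin> e ` {..<n}" using * V.span_base by metis
    ultimately show False using card_image[OF inj_e] by simp
  qed
  then obtain u where "q mod f = (\<Sum>x\<in>e ` {..<n}. smult (u x) x)"
    by (auto simp: V.span_finite)
  also have "\<dots> = pcompose (\<Sum>i<n. monom (u (e i)) i) r mod f"
    by (simp add: sum.reindex[OF inj_e] lin)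
  finally show "\<exists>q'. f dvd pcompose q' r - q"
    by (metis mod_eq_dvd_iff)
qed

text \<open>The roots of \<open>g\<close> are \<open>u\<close> times those of \<open>f\<close>:
  substituting \<open>u X\<close> into \<open>g\<close> gives \<open>u ^ n * f\<close>. This
  substitution preserves degrees, so it is injective on remainders.\<close>

lemma quot_equiv_scale:
  fixes f g :: "'a::field poly"
  assumes deg: "degree f = n" "degree g = n" "0 < n" and u: "u \<noteq> 0"
    and coeff: "\<And>i. i \<le> n \<Longrightarrow> coeff g i = u ^ (n - i) * coeff f i"
  shows "f \<sim>\<^sub>Q g"
proof (rule quot_equivI[OF deg, where r = "[:0, u:]"])
  have "pcompose g [:0, u:] = smult (u ^ n) f"
  proof (rule poly_eqI)
    fix i
    show "coeff (pcompose g [:0, u:]) i = coeff (smult (u ^ n) f) i"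
    proof (cases "i \<le> n")
      case True
      then have "u ^ i * u ^ (n - i) = u ^ n" by (simp flip: power_add)
      then show ?thesis
        using coeff[OF True] by (simp add: coeff_pcompose_linear mult.assoc[symmetric])
    next
      case False
      then show ?thesis using deg by (simp add: coeff_pcompose_linear coeff_eq_0)
    qed
  qed
  then show "f dvd pcompose g [:0, u:]" by (simp add: dvd_smult)
next
  fix q assume q: "degree q < n" "f dvd pcompose q [:0, u:]"
  have "degree (pcompose q [:0, u:]) < n" using q(1) u by (simp add: degree_pcompose)
  then have "pcompose q [:0, u:] = 0"
    using q(2) deg by (auto dest: dvd_imp_degree_le)
  then show "q = 0" by (rule pcompose_eq_0) (use u in simp)
qed

subsection \<open>The p-adic integers\<close>

lemma Rep_padic_int_eq_iff:
  fixes x y :: "'p::prime_card padic_int"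
  shows "Rep_padic_int x n = Rep_padic_int y n \<longleftrightarrow> of_nat CARD('p) ^ n dvd x - y"
proof -
  have "of_nat CARD('p) ^ n dvd x - y \<longleftrightarrow>
      Rep_padic_int x n mod int CARD('p) ^ n = Rep_padic_int y n mod int CARD('p) ^ n"
    by (simp add: padic_int_dvd_pow_iff minus_padic_int.rep_eq mod_eq_dvd_iff mod_eq_0_iff_dvd)
  then show ?thesis by (simp add: Rep_padic_int_mod)
qed

lemma padic_int_eq_0I:
  fixes x :: "'p::prime_card padic_int"
  assumes "\<And>n. of_nat CARD('p) ^ n dvd x"
  shows "x = 0"
  using assms padic_int_nonzero_index[of x] by (auto simp: padic_int_dvd_pow_iff)

text \<open>Completeness of the p-adic integers: modulo \<open>p ^ n\<close> the partial sums no
  longer change after the \<open>n\<close>-th one, so their residues form a coherent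
  sequence.\<close>

lemma padic_int_series:
  fixes d :: "nat \<Rightarrow> 'p::prime_card padic_int"
  obtains z where "\<And>n. of_nat CARD('p) ^ n dvd z - (\<Sum>i<n. of_nat CARD('p) ^ i * d i)"
proof -
  define S where "S n = (\<Sum>i<n. of_nat CARD('p) ^ i * d i)" for n
  define x where "x n = Rep_padic_int (S n) n" for n
  have "Rep_padic_int (S (Suc n)) n = Rep_padic_int (S n) n" for n
    by (simp add: Rep_padic_int_eq_iff S_def)
  then have "x (Suc n) mod int CARD('p) ^ n = x n" for n
    using Rep_padic_int_mod[of n "Suc n" "S (Suc n)"] by (simp add: x_def)
  then have "x \<in> {x :: nat \<Rightarrow> int. \<forall>n. x n \<in> {0..<int CARD('p) ^ n} \<and>
      x (Suc n) mod int CARD('p) ^ n = x n}"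
    by (simp add: x_def Rep_padic_int_bounds)
  then have "Rep_padic_int (Abs_padic_int x :: 'p padic_int) n = Rep_padic_int (S n) n" for n
    by (simp add: Abs_padic_int_inverse x_def)
  then have "of_nat CARD('p) ^ n dvd Abs_padic_int x - S n" for n
    by (simp add: Rep_padic_int_eq_iff)
  then show ?thesis unfolding S_def by (rule that)
qed

text \<open>A natural representative modulo \<open>p\<close> makes Fermat's little theorem available
  for p-adic integers.\<close>

lemma padic_int_residue:
  fixes x :: "'p::prime_card padic_int"
  obtains k :: nat where "of_nat CARD('p) dvd x - of_nat k"
proof -
  have "Rep_padic_int (of_nat (nat (Rep_padic_int x 1)) :: 'p padic_int) 1 = Rep_padic_int x 1"
    using Rep_padic_int_of_int[of "Rep_padic_int x 1" 1, where 'p = 'p] Rep_padic_int_bounds[of x 1]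
    by simp
  then have "of_nat CARD('p) dvd x - of_nat (nat (Rep_padic_int x 1))"
    unfolding Rep_padic_int_eq_iff by (metis dvd_minus_iff minus_diff_eq power_one_right)
  then show ?thesis by (rule that)
qed

lemma of_nat_fermat:
  assumes "prime p"
  shows "(of_nat p :: 'a::comm_ring_1) dvd of_nat k ^ p - of_nat k"
proof -
  have "[k ^ p = k] (mod p)"
  proof (cases "p dvd k")
    case True
    then show ?thesis
      using assms by (metis cong_0_iff cong_sym_eq cong_trans dvd_power prime_gt_0_nat dvd_trans)
  next
    case False
    have "[k * k ^ (p - 1) = k * 1] (mod p)"
      by (rule cong_scalar_left) (rule fermat_theorem[OF assms False])
    then show ?thesis using prime_gt_0_nat[OF assms] by (simp flip: power_Suc)
  qed
  then have "int p dvd int k ^ p - int k"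
    by (metis cong_iff_dvd_diff cong_int_iff of_nat_power)
  then obtain m where "int k ^ p - int k = int p * m" by (auto simp: dvd_def)
  then have "(of_int (int k ^ p - int k) :: 'a) = of_int (int p * m)" by simp
  then show ?thesis by simp
qed

subsection \<open>Ideals with two generators and binomial expansions\<close>

text \<open>With \<open>F\<close> as first generator, membership expresses a congruence in
  \<open>A / (F)\<close> modulo the second generator, while all computations stay in the polynomial
  ring.\<close>

definition ideal2 :: "'a::comm_ring_1 \<Rightarrow> 'a \<Rightarrow> 'a set" where
  "ideal2 a b = {a * u + b * v |u v. True}"

lemma ideal2I: "x = a * u + b * v \<Longrightarrow> x \<in> ideal2 a b"
  by (auto simp: ideal2_def)

lemma ideal2E:
  assumes "x \<in> ideal2 a b"
  obtains u v where "x = a * u + b * v"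
  using assms by (auto simp: ideal2_def)

lemma ideal2_dvd1: "a dvd x \<Longrightarrow> x \<in> ideal2 a b"
  using ideal2I[of x a _ b 0] by (auto elim!: dvdE)

lemma ideal2_dvd2: "b dvd x \<Longrightarrow> x \<in> ideal2 a b"
  using ideal2I[of x a 0 b] by (auto elim!: dvdE)

lemma ideal2_add: "x \<in> ideal2 a b \<Longrightarrow> y \<in> ideal2 a b \<Longrightarrow> x + y \<in> ideal2 a b"
proof (elim ideal2E)
  fix u v u' v' assume "x = a * u + b * v" "y = a * u' + b * v'"
  then have "x + y = a * (u + u') + b * (v + v')" by (simp add: algebra_simps)
  then show ?thesis by (rule ideal2I)
qed

lemma ideal2_mult: "x \<in> ideal2 a b \<Longrightarrow> y \<in> ideal2 a c \<Longrightarrow> x * y \<in> ideal2 a (b * c)"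
proof (elim ideal2E)
  fix u v u' v' assume "x = a * u + b * v" "y = a * u' + c * v'"
  then have "x * y = a * (u * y + b * v * u') + b * c * (v * v')"
    by (simp add: algebra_simps)
  then show ?thesis by (rule ideal2I)
qed

lemma ideal2_mult_left: "x \<in> ideal2 a b \<Longrightarrow> c * x \<in> ideal2 a b"
proof (elim ideal2E)
  fix u v assume "x = a * u + b * v"
  then have "c * x = a * (c * u) + b * (c * v)" by (simp add: algebra_simps)
  then show ?thesis by (rule ideal2I)
qed

lemma ideal2_mult_right: "x \<in> ideal2 a b \<Longrightarrow> x * c \<in> ideal2 a b"
  using ideal2_mult_left[of x a b c] by (simp add: mult.commute)

lemma ideal2_minus: "x \<in> ideal2 a b \<Longrightarrow> - x \<in> ideal2 a b"
  using ideal2_mult_left[of x a b "- 1"] by simp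

lemma ideal2_diff: "x \<in> ideal2 a b \<Longrightarrow> y \<in> ideal2 a b \<Longrightarrow> x - y \<in> ideal2 a b"
  using ideal2_add[of x a b "- y"] ideal2_minus[of y a b] by simp

lemma ideal2_mono: "x \<in> ideal2 a b \<Longrightarrow> b \<in> ideal2 a c \<Longrightarrow> x \<in> ideal2 a c"
  by (metis ideal2E ideal2_add ideal2_dvd1 ideal2_mult_right dvd_triv_left)

section \<open>Binomial expansions\<close>

lemma power_add_first_order:
  fixes a b :: "'a::comm_ring_1"
  obtains S where "(a + b) ^ Suc n = a ^ Suc n + of_nat (Suc n) * a ^ n * b + b\<^sup>2 * S"
proof -
  have "\<exists>S. (a + b) ^ Suc n = a ^ Suc n + of_nat (Suc n) * a ^ n * b + b\<^sup>2 * S"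
  proof (induction n)
    case (Suc n)
    then obtain S where S: "(a + b) ^ Suc n = a ^ Suc n + of_nat (Suc n) * a ^ n * b + b\<^sup>2 * S"
      by blast
    have "(a + b) ^ Suc (Suc n) = (a + b) * (a + b) ^ Suc n" by simp
    also have "\<dots> = a ^ Suc (Suc n) + of_nat (Suc (Suc n)) * a ^ Suc n * b
        + b\<^sup>2 * (of_nat (Suc n) * a ^ n + (a + b) * S)"
      unfolding S by (simp add: algebra_simps power2_eq_square)
    finally show ?case by blast
  qed (auto intro: exI[of _ 0])
  then show ?thesis using that by blast
qed

text \<open>The coefficients \<open>p choose k\<close> with \<open>0 < k < p\<close> are divisible
  by \<open>p\<close>. Splitting off \<open>k = 0, 1, p\<close> leaves a remainder with both factors
  \<open>p\<close> and \<open>b ^ 2\<close>, so that orders can be read off in the Newton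
  steps.\<close>

lemma power_prime_add:
  fixes a b :: "'a::comm_ring_1"
  assumes "prime p"
  obtains S where
    "(a + b) ^ p = a ^ p + b ^ p + of_nat p * a ^ (p - 1) * b + of_nat p * (b\<^sup>2 * S)"
proof -
  have p: "p \<ge> 2" using assms by (rule prime_ge_2_nat)
  have choose: "of_nat p * of_nat ((p choose k) div p) = (of_nat (p choose k) :: 'a)"
    if "k \<in> {2..<p}" for k
    using that dvd_choose_prime[of k p] assms by (simp flip: of_nat_mult)
  define S where "S = (\<Sum>k\<in>{2..<p}. of_nat ((p choose k) div p) * b ^ (k - 2) * a ^ (p - k))"
  have set: "{..p} = insert 0 (insert 1 (insert p {2..<p}))" using p by auto
  have "(a + b) ^ p = (\<Sum>k\<le>p. of_nat (p choose k) * b ^ k * a ^ (p - k))"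
    by (subst add.commute) (rule binomial_ring)
  also have "\<dots> = a ^ p + b ^ p + of_nat p * a ^ (p - 1) * b
      + (\<Sum>k\<in>{2..<p}. of_nat (p choose k) * b ^ k * a ^ (p - k))"
    using p unfolding set by (simp add: algebra_simps)
  also have "(\<Sum>k\<in>{2..<p}. of_nat (p choose k) * b ^ k * a ^ (p - k)) = of_nat p * (b\<^sup>2 * S)"
    unfolding S_def sum_distrib_left
  proof (rule sum.cong)
    fix k assume k: "k \<in> {2..<p}"
    then have "b ^ k = b\<^sup>2 * b ^ (k - 2)" by (metis atLeastLessThan_iff le_add_diff_inverse power_add)
    then show "of_nat (p choose k) * b ^ k * a ^ (p - k)
        = of_nat p * (b\<^sup>2 * (of_nat ((p choose k) div p) * b ^ (k - 2) * a ^ (p - k)))"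
      unfolding choose[OF k, symmetric] by (simp only: mult_ac)
  qed simp
  finally show ?thesis by (rule that)
qed

lemma dvd_power_diff_1: "(x :: 'a::comm_ring_1) dvd v - 1 \<Longrightarrow> x dvd v ^ n - 1"
  using power_diff_1_eq[of v n] by (metis dvd_mult2)

lemma pcompose_diff_dvd:
  fixes x y :: "'a::comm_ring_1 poly"
  shows "x - y dvd pcompose g x - pcompose g y"
proof (induction g)
  case (pCons a g)
  have "pcompose (pCons a g) x - pcompose (pCons a g) y
      = x * (pcompose g x - pcompose g y) + (x - y) * pcompose g y"
    by (simp add: pcompose_pCons algebra_simps)
  then show ?case using pCons.IH by (metis dvd_add dvd_mult dvd_triv_left)
qed simp

definition polyX :: "'a::comm_semiring_1 poly" where "polyX = [:0, 1:]"

lemma polyX_power: "polyX ^ n = monom 1 n"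
  by (simp add: polyX_def monom_altdef)

lemma polyX_mult: "polyX * q = pCons 0 q" for q :: "'a::comm_ring_1 poly"
  by (simp add: polyX_def)

lemma coeff_polyX_power_mult:
  "coeff (polyX ^ n * q) k = (if k < n then 0 else coeff q (k - n))" for q :: "'a::comm_ring_1 poly"
  by (simp add: polyX_power coeff_monom_mult)

lemma poly_split_polyX:
  fixes q :: "'a::comm_ring_1 poly"
  obtains q' where "q = [:coeff q 0:] + polyX * q'"
  by (cases q) (simp add: polyX_mult)

lemma of_nat_poly_dvd_iff:
  fixes q :: "'a::idom poly"
  shows "of_nat m dvd q \<longleftrightarrow> (\<forall>i. of_nat m dvd coeff q i)"
  using const_poly_dvd_iff[of "of_nat m" q] by (simp add: of_nat_poly)

subsection \<open>Newton approximation modulo an Eisenstein polynomial\<close>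

lemma pcompose_power: "pcompose (q ^ n) r = pcompose q r ^ n" for q r :: "'a::comm_semiring_1 poly"
  by (induction n) (simp_all add: pcompose_1 pcompose_mult)

lemma pcompose_of_nat [simp]: "pcompose (of_nat n) r = of_nat n" for r :: "'a::comm_semiring_1 poly"
  by (simp add: of_nat_poly)

lemma pcompose_polyX [simp]: "pcompose polyX r = r" for r :: "'a::comm_ring_1 poly"
  by (simp add: polyX_def pcompose_pCons)

text \<open>Approximations are congruent to \<open>X\<close> modulo \<open>X ^ 2\<close>; the
  cofactor \<open>V\<close> lets all powers of \<open>X\<close> be pulled out of the terms of
  \<open>G(Y)\<close>.\<close>

lemma polyX_factor:
  fixes Y Y0 :: "'a::comm_ring_1 poly"
  assumes "polyX ^ k dvd Y - Y0" "k \<ge> 2" "polyX ^ 2 dvd Y0 - polyX"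
  obtains V where "Y = polyX * V" "polyX dvd V - 1"
proof -
  have "polyX ^ 2 dvd (Y - Y0) + (Y0 - polyX)"
    using assms by (intro dvd_add) (auto intro: dvd_trans[OF le_imp_power_dvd])
  then have "polyX ^ 2 dvd Y - polyX" by simp
  then obtain q where "Y - polyX = polyX ^ 2 * q" by (elim dvdE)
  then have "Y = polyX * (1 + polyX * q)" by (simp add: algebra_simps power2_eq_square)
  then show ?thesis by (rule that) simp
qed

text \<open>Eisenstein polynomials are parametrized as \<open>F = X ^ p + p * B\<close>: the degree
  bound on \<open>B\<close> makes \<open>F\<close> monic of degree \<open>p\<close>, and the unit
  condition says that its constant coefficient has valuation \<open>1\<close>.\<close>

locale eisenstein_poly =
  fixes B :: "'p::prime_card padic_int poly" and p :: nat
  assumes p_eq: "p = CARD('p)"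
    and degree_B: "degree B < p"
    and unit_B: "coeff B 0 dvd 1"
    and odd_p: "odd p"
begin

abbreviation P :: "'p padic_int poly" where "P \<equiv> of_nat p"

definition F :: "'p padic_int poly" where "F = polyX ^ p + P * B"
definition b0 :: "'p padic_int poly" where "b0 = [:coeff B 0:]"
abbreviation I :: "nat \<Rightarrow> 'p padic_int poly set" where "I n \<equiv> ideal2 F (polyX ^ n)"
text \<open>\<open>I\<close> measures orders with respect to the uniformizer, \<open>J\<close> with
  respect to \<open>p\<close>. Corrections are computed in \<open>I\<close>; limits are taken in
  \<open>J\<close>, where convergence can be checked coefficientwise.\<close>

abbreviation J :: "nat \<Rightarrow> 'p padic_int poly set" where "J n \<equiv> ideal2 F (P ^ n)"

lemma prime_p: "prime p" unfolding p_eq by (rule prime_card)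

lemma p_ge_3: "p \<ge> 3"
  using prime_ge_2_nat[OF prime_p] odd_p by (cases "p = 2") auto

lemma coeff_F_ge: "i \<ge> p \<Longrightarrow> coeff F i = (if i = p then 1 else 0)"
  using degree_B by (simp add: F_def polyX_power coeff_eq_0 of_nat_poly)

lemma degree_F: "degree F = p"
proof (rule antisym)
  show "degree F \<le> p" by (rule degree_le) (simp add: coeff_F_ge)
  show "p \<le> degree F" by (rule le_degree) (simp add: coeff_F_ge)
qed

lemma F_nonzero: "F \<noteq> 0"
  using degree_F p_ge_3 by auto

lemma lead_coeff_F: "lead_coeff F = 1"
  by (simp add: degree_F coeff_F_ge)

lemma division:
  obtains q r where "h = F * q + r" "degree r < p"
proof -
  obtain q r where qr: "pseudo_divmod h F = (q, r)" by force
  have "h = F * q + r"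
    using pseudo_divmod(1)[OF F_nonzero qr] by (simp add: lead_coeff_F)
  moreover have "degree r < p"
    using pseudo_divmod(2)[OF F_nonzero qr] degree_F p_ge_3 by auto
  ultimately show ?thesis by (rule that)
qed

lemma dvd_small: "F dvd h \<Longrightarrow> degree h < p \<Longrightarrow> h = 0"
  using dvd_imp_degree_le[of F h] by (auto simp: degree_F)

lemma b0_unit: obtains c where "c * b0 = 1"
proof -
  obtain c where "1 = coeff B 0 * c" using unit_B by (elim dvdE)
  then have "[:c:] * b0 = 1" by (simp add: b0_def mult.commute one_pCons)
  then show ?thesis by (rule that)
qed

lemma B_split: obtains B' where "polyX * B' = B - b0"
  using poly_split_polyX[of B] unfolding b0_def by (metis add_diff_cancel_left')

section \<open>Orders of \<open>p\<close> and \<open>X ^ p\<close> in the filtration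
  \<open>I\<close>\<close>

lemma I_mono: "x \<in> I n \<Longrightarrow> m \<le> n \<Longrightarrow> x \<in> I m"
  by (rule ideal2_mono) (auto intro: ideal2_dvd2 le_imp_power_dvd)

lemma I_mult: "x \<in> I m \<Longrightarrow> y \<in> I n \<Longrightarrow> n' \<le> m + n \<Longrightarrow> x * y \<in> I n'"
  by (rule I_mono[where n = "m + n"]) (auto simp: power_add intro: ideal2_mult)

lemma F_in_I: "F * q \<in> I n"
  by (rule ideal2_dvd1) simp

lemma X_in_I: "m \<le> n \<Longrightarrow> polyX ^ n * q \<in> I m"
  by (rule ideal2_dvd2) (auto intro: dvd_mult2 le_imp_power_dvd)

text \<open>
  Since \<open>P * b0 = F - X ^ p - P * X * B'\<close>, membership of \<open>P\<close> in \<open>I k\<close> improves to \<open>I (k + 1)\<close> as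
  long as \<open>k < p\<close>.
\<close>

lemma P_in_I: "P \<in> I p"
proof -
  obtain B' where B': "polyX * B' = B - b0" by (rule B_split)
  obtain c where c: "c * b0 = 1" by (rule b0_unit)
  have "P \<in> I k" if "k \<le> p" for k
    using that
  proof (induction k)
    case 0
    show ?case by (rule ideal2_dvd2) simp
  next
    case (Suc k)
    have "P * polyX \<in> I (Suc k)"
      using Suc by (intro I_mult[of P k polyX 1]) (auto intro: ideal2_dvd2)
    then have "P * (polyX * B') \<in> I (Suc k)"
      unfolding mult.assoc[symmetric] by (rule ideal2_mult_right)
    then have "F * 1 - polyX ^ p * 1 - P * (polyX * B') \<in> I (Suc k)"
      using Suc.prems by (intro ideal2_diff F_in_I X_in_I)
    then have "c * (F * 1 - polyX ^ p * 1 - P * (polyX * B')) \<in> I (Suc k)"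
      by (rule ideal2_mult_left)
    also have "c * (F * 1 - polyX ^ p * 1 - P * (polyX * B')) = c * b0 * P"
      unfolding B' by (simp add: F_def algebra_simps)
    finally show ?case by (simp add: c)
  qed
  then show ?thesis by simp
qed

lemma P_power_in_I: "P ^ n \<in> I (p * n)"
  by (induction n) (auto intro: ideal2_dvd2 I_mult P_in_I)

lemma PX_in_I: "n \<le> p * i + j \<Longrightarrow> P ^ i * polyX ^ j * q \<in> I n"
  using I_mult[OF P_power_in_I X_in_I[of j j q], of n i] by (simp add: mult.assoc)

lemma PX1_in_I: "n \<le> p + j \<Longrightarrow> P * polyX ^ j * q \<in> I n"
  using PX_in_I[of n 1 j q] by simp

text \<open>Up to higher order \<open>X ^ p\<close> may be replaced by \<open>- p * b0\<close>; this
  is how terms \<open>X ^ (p + j)\<close> and \<open>p X ^ j\<close> are made to cancel.\<close>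

lemma Xp_in_I: "polyX ^ p + P * b0 \<in> I (Suc p)"
proof -
  obtain B' where B': "polyX * B' = B - b0" by (rule B_split)
  have "F * 1 - P * polyX ^ 1 * B' \<in> I (Suc p)"
    by (intro ideal2_diff F_in_I PX1_in_I) simp
  also have "F * 1 - P * polyX ^ 1 * B' = polyX ^ p + P * b0"
    unfolding power_one_right mult.assoc B' by (simp add: F_def algebra_simps)
  finally show ?thesis .
qed

section \<open>Separatedness and completeness of the filtration \<open>J\<close>\<close>

lemma I_imp_J: "x \<in> I (p * n) \<Longrightarrow> x \<in> J n"
proof (erule ideal2_mono)
  \<comment> \<open>Since \<open>X ^ p = F - p * B\<close>, a block of \<open>p\<close> factors
    \<open>X\<close> yields one factor \<open>p\<close> modulo \<open>F\<close>.\<close>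
  have "polyX ^ p \<in> J 1"
    by (rule ideal2I[where u = 1 and v = "- B"]) (simp add: F_def)
  then have "(polyX ^ p) ^ n \<in> J n"
  proof (induction n)
    case (Suc n)
    then show ?case using ideal2_mult[of "polyX ^ p" F "P ^ 1" "(polyX ^ p) ^ n" "P ^ n"] by simp
  qed (simp add: ideal2_dvd2)
  then show "polyX ^ (p * n) \<in> J n" by (simp add: power_mult)
qed

lemma J_reduce:
  assumes "x \<in> J n"
  obtains y where "degree y < p" "F dvd x - P ^ n * y"
proof -
  obtain u v where uv: "x = F * u + P ^ n * v" using assms by (rule ideal2E)
  obtain q y where qy: "v = F * q + y" "degree y < p" by (rule division)
  have "x - P ^ n * y = F * (u + P ^ n * q)" by (simp add: uv qy algebra_simps)
  then show ?thesis using qy(2) that by (metis dvd_triv_left)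
qed

text \<open>Remainders of degree below \<open>p\<close> are unique, so the remainder of
  \<open>x\<close> equals \<open>P ^ n * y\<close> exactly and is divisible by every power of
  \<open>p\<close>.\<close>

lemma J_separated:
  assumes "\<And>n. x \<in> J n"
  shows "F dvd x"
proof -
  obtain q r where qr: "x = F * q + r" "degree r < p" by (rule division)
  have "P ^ n dvd r" for n
  proof -
    obtain y where y: "degree y < p" "F dvd x - P ^ n * y" using assms[of n] by (rule J_reduce)
    have "F dvd r - P ^ n * y"
      using y(2) by (simp add: qr add_diff_eq[symmetric] dvd_add_right_iff)
    moreover have "degree (r - P ^ n * y) < p"
      using y(1) qr(2)
      by (intro degree_diff_less) (auto simp: of_nat_poly[of p] poly_const_pow)
    ultimately have "r = P ^ n * y" using dvd_small by force
    then show ?thesis by simp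
  qed
  then have "of_nat p ^ n dvd coeff r i" for n i
    using of_nat_poly_dvd_iff[of "p ^ n" r] by simp
  then have "coeff r i = 0" for i unfolding p_eq by (rule padic_int_eq_0I)
  then have "r = 0" by (simp add: poly_eq_iff)
  then show ?thesis by (simp add: qr)
qed

text \<open>Modulo \<open>F\<close> each increment is \<open>p ^ n\<close> times a polynomial of
  degree below \<open>p\<close>, so the series of increments converges coefficientwise.\<close>

lemma J_complete:
  fixes Y :: "nat \<Rightarrow> 'p padic_int poly"
  assumes "\<And>n. Y (Suc n) - Y n \<in> J n"
  obtains R where "\<And>n. R - Y n \<in> J n"
proof -
  have "\<exists>y. degree y < p \<and> F dvd Y (Suc n) - Y n - P ^ n * y" for n
    using assms[of n] by (meson J_reduce)
  then obtain y where y: "\<And>n. degree (y n) < p" "\<And>n. F dvd Y (Suc n) - Y n - P ^ n * y n"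
    by metis
  define S where "S n = (\<Sum>i<n. P ^ i * y i)" for n
  have S: "F dvd Y n - Y 0 - S n" for n
  proof (induction n)
    case (Suc n)
    have "Y (Suc n) - Y 0 - S (Suc n) = (Y (Suc n) - Y n - P ^ n * y n) + (Y n - Y 0 - S n)"
      by (simp add: S_def)
    then show ?case using Suc y(2)[of n] by (metis dvd_add)
  qed (simp add: S_def)
  have "\<exists>z. \<forall>n. of_nat p ^ n dvd z - (\<Sum>i<n. of_nat p ^ i * coeff (y i) k)" for k
    unfolding p_eq by (rule padic_int_series[of "\<lambda>i. coeff (y i) k"]) blast
  then obtain z where z: "\<And>k n. of_nat p ^ n dvd z k - (\<Sum>i<n. of_nat p ^ i * coeff (y i) k)"
    by metis
  define Z where "Z = (\<Sum>k<p. monom (z k) k)"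
  have Z: "P ^ n dvd Z - S n" for n
  proof -
    have "of_nat p ^ n dvd coeff (Z - S n) k" for k
    proof (cases "k < p")
      case True
      have "coeff (Z - S n) k = z k - (\<Sum>i<n. of_nat p ^ i * coeff (y i) k)"
        using True by (simp add: Z_def S_def coeff_sum of_nat_poly poly_const_pow)
      then show ?thesis using z by simp
    next
      case False
      then have "coeff (y i) k = 0" for i using y(1)[of i] by (intro coeff_eq_0) simp
      then show ?thesis
        using False by (simp add: Z_def S_def coeff_sum of_nat_poly poly_const_pow)
    qed
    then show ?thesis using of_nat_poly_dvd_iff[of "p ^ n" "Z - S n"] by simp
  qed
  have "Y 0 + Z - Y n \<in> J n" for n
  proof -
    have "(Z - S n) - (Y n - Y 0 - S n) \<in> J n"
      using Z S by (intro ideal2_diff ideal2_dvd1 ideal2_dvd2)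
    then show ?thesis by (simp add: algebra_simps)
  qed
  then show ?thesis by (rule that)
qed

text \<open>A correction by \<open>X ^ (k + n) * s\<close> changes the value by
  \<open>c * s * p X ^ (M + n)\<close> up to higher order. As \<open>c\<close> is a unit, any error
  of order \<open>M + p + n\<close> can be cancelled, and all approximations stay congruent to
  \<open>Y0\<close> modulo \<open>X ^ k\<close>.\<close>

lemma hensel:
  assumes k: "k \<ge> 2"
    and start: "pcompose G Y0 \<in> I (M + p)"
    and c: "c * c' = 1"
    and step: "\<And>n Y s. polyX ^ k dvd Y - Y0 \<Longrightarrow>
      pcompose G (Y + polyX ^ (k + n) * s) - pcompose G Y - P * polyX ^ (M + n) * (c * s)
        \<in> I (Suc (M + p + n))"
  obtains R where "F dvd pcompose G R" "R - Y0 \<in> I 2"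
proof -
  have "\<exists>Y. \<forall>n. (pcompose G (Y n) \<in> I (M + p + n) \<and> polyX ^ k dvd Y n - Y0) \<and>
      polyX ^ (k + n) dvd Y (Suc n) - Y n"
  proof (rule dependent_nat_choice)
    show "\<exists>Y. pcompose G Y \<in> I (M + p + 0) \<and> polyX ^ k dvd Y - Y0"
      using start by (intro exI[of _ Y0]) simp
  next
    fix Y n
    assume Y: "pcompose G Y \<in> I (M + p + n) \<and> polyX ^ k dvd Y - Y0"
    then obtain u v where uv: "pcompose G Y = F * u + polyX ^ (M + p + n) * v"
      by (elim conjE ideal2E)
    \<comment> \<open>Up to a multiple of \<open>F\<close> and higher order, the error
      \<open>X ^ (M + p + n) * v\<close> equals \<open>- p b0 v X ^ (M + n)\<close>, so
      \<open>s\<close> has to satisfy \<open>c * s = b0 * v\<close>.\<close>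
    define s where "s = c' * b0 * v"
    define Y' where "Y' = Y + polyX ^ (k + n) * s"
    have cs: "c * s = b0 * v"
      using c by (simp add: s_def mult.assoc[symmetric])
    have "polyX ^ (M + n) * (polyX ^ p + P * b0) \<in> I (Suc (M + p + n))"
      by (rule I_mult[OF _ Xp_in_I, of _ "M + n"]) (auto intro: ideal2_dvd2)
    then have "polyX ^ (M + n) * (polyX ^ p + P * b0) * v \<in> I (Suc (M + p + n))"
      by (rule ideal2_mult_right)
    moreover have "pcompose G Y' - pcompose G Y - P * polyX ^ (M + n) * (c * s)
        \<in> I (Suc (M + p + n))"
      unfolding Y'_def using Y by (intro step) simp
    ultimately have "(pcompose G Y' - pcompose G Y - P * polyX ^ (M + n) * (c * s))
        + (F * u + polyX ^ (M + n) * (polyX ^ p + P * b0) * v) \<in> I (Suc (M + p + n))"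
      by (intro ideal2_add F_in_I)
    also have "(pcompose G Y' - pcompose G Y - P * polyX ^ (M + n) * (c * s))
        + (F * u + polyX ^ (M + n) * (polyX ^ p + P * b0) * v) = pcompose G Y'"
      unfolding cs uv by (simp add: algebra_simps power_add)
    finally have "pcompose G Y' \<in> I (M + p + Suc n)" by simp
    moreover have "polyX ^ k dvd Y' - Y0"
    proof -
      have "Y' - Y0 = (Y - Y0) + polyX ^ k * (polyX ^ n * s)"
        by (simp add: Y'_def power_add algebra_simps)
      then show ?thesis using Y by (metis dvd_add dvd_triv_left)
    qed
    moreover have "polyX ^ (k + n) dvd Y' - Y" by (simp add: Y'_def)
    ultimately show "\<exists>Y'. (pcompose G Y' \<in> I (M + p + Suc n) \<and> polyX ^ k dvd Y' - Y0) \<and>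
        polyX ^ (k + n) dvd Y' - Y"
      by blast
  qed
  then obtain Y where Y: "\<And>n. pcompose G (Y n) \<in> I (M + p + n)" "\<And>n. polyX ^ k dvd Y n - Y0"
    "\<And>n. polyX ^ (k + n) dvd Y (Suc n) - Y n"
    by blast
  have Y_dvd: "polyX ^ n dvd Y (n + j) - Y n" for n j
  proof (induction j)
    case (Suc j)
    have "polyX ^ n dvd Y (Suc (n + j)) - Y (n + j)"
      by (rule dvd_trans[OF le_imp_power_dvd Y(3)]) simp
    then have "polyX ^ n dvd (Y (Suc (n + j)) - Y (n + j)) + (Y (n + j) - Y n)"
      using Suc by (rule dvd_add)
    then show ?case by simp
  qed simp
  \<comment> \<open>Only every \<open>p\<close>-th approximation is used, because \<open>p\<close>
    orders in \<open>X\<close> amount to one power of \<open>p\<close> modulo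
    \<open>F\<close>.\<close>
  have "Y (p * Suc n) - Y (p * n) \<in> J n" for n
    using Y_dvd[of "p * n" p] by (intro I_imp_J ideal2_dvd2) (simp add: add.commute)
  then obtain R where R: "\<And>n. R - Y (p * n) \<in> J n"
    using J_complete[of "\<lambda>n. Y (p * n)"] by blast
  have "pcompose G R \<in> J n" for n
  proof -
    have "pcompose G (Y (p * n)) \<in> J n"
      by (rule I_imp_J) (rule I_mono[OF Y(1)], simp)
    moreover have "pcompose G R - pcompose G (Y (p * n)) \<in> J n"
      using R[of n] pcompose_diff_dvd[of R "Y (p * n)" G] by (auto elim!: dvdE intro: ideal2_mult_right)
    ultimately show ?thesis using ideal2_add by fastforce
  qed
  then have 1: "F dvd pcompose G R" by (rule J_separated)
  have "R - Y (p * 1) \<in> I p"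
    using R[of 1] by (rule ideal2_mono) (simp add: P_in_I)
  then have "R - Y (p * 1) \<in> I 2" by (rule I_mono) (use p_ge_3 in simp)
  moreover have "polyX ^ 2 dvd Y (p * 1) - Y0"
    by (rule dvd_trans[OF le_imp_power_dvd Y(2)]) (rule k)
  then have "Y (p * 1) - Y0 \<in> I 2" by (rule ideal2_dvd2)
  ultimately have "(R - Y (p * 1)) + (Y (p * 1) - Y0) \<in> I 2" by (rule ideal2_add)
  then have "R - Y0 \<in> I 2" by simp
  with 1 show ?thesis by (rule that)
qed

text \<open>Modulo \<open>I (j + 1)\<close>, only the first coefficient of \<open>Q\<close> that is a unit contributes to \<open>Q \<circ> R\<close>.\<close>

lemma pcompose_not_dvd:
  assumes R: "R - polyX \<in> I 2"
    and Q: "degree Q < p" "\<not> of_nat p dvd coeff Q i"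
  shows "\<not> F dvd pcompose Q R"
proof
  assume dvd: "F dvd pcompose Q R"
  define j where "j = (LEAST i. \<not> of_nat p dvd coeff Q i)"
  have j: "\<not> of_nat p dvd coeff Q j" unfolding j_def using Q(2) by (rule LeastI)
  have less_j: "of_nat p dvd coeff Q i" if "i < j" for i
    using not_less_Least[of i] that by (auto simp: j_def)
  have "coeff Q j \<noteq> 0" using j by auto
  then have "j < p" using Q(1) le_degree[of Q j] by simp
  have R1: "R \<in> I 1"
  proof -
    have "(R - polyX) + polyX \<in> I 1"
      using I_mono[OF R, of 1] by (intro ideal2_add) (simp_all add: ideal2_dvd2)
    then show ?thesis by simp
  qed
  have Rj: "R ^ i - polyX ^ i \<in> I (Suc i)" for i
  proof (induction i)
    case (Suc i)
    have "R * (R ^ i - polyX ^ i) + (R - polyX) * (polyX ^ i * 1)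
        \<in> I (Suc (Suc i))"
      by (intro ideal2_add I_mult[OF R1 Suc] I_mult[OF R X_in_I[OF order_refl]]) simp_all
    then show ?case by (simp add: algebra_simps)
  qed (auto intro: ideal2_dvd2)
  have Ri: "R ^ i \<in> I i" for i
  proof (induction i)
    case (Suc i)
    show ?case using I_mult[OF R1 Suc, of "Suc i"] by simp
  qed (auto intro: ideal2_dvd2)
  have "P dvd poly_cutoff j Q"
    using of_nat_poly_dvd_iff[of p "poly_cutoff j Q"] less_j by (simp add: coeff_poly_cutoff)
  then obtain Q1 where Q1: "poly_cutoff j Q = P * Q1" by (elim dvdE)
  obtain Q2 where Q2: "poly_shift j Q = [:coeff Q j:] + polyX * Q2"
    by (rule poly_split_polyX[of "poly_shift j Q", unfolded coeff_poly_shift add_0_left])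
  have "Q = poly_cutoff j Q + polyX ^ j * poly_shift j Q"
    by (rule poly_eqI)
      (simp add: coeff_polyX_power_mult coeff_poly_cutoff coeff_poly_shift)
  then have "pcompose Q R = pcompose (P * Q1 + polyX ^ j * ([:coeff Q j:] + polyX * Q2)) R"
    by (simp only: Q1 Q2)
  also have "\<dots> = P * pcompose Q1 R + R ^ j * ([:coeff Q j:] + R * pcompose Q2 R)"
    by (simp add: pcompose_add pcompose_mult pcompose_power del: mult_pCons_left mult_pCons_right)
  finally have comp: "pcompose Q R = \<dots>" .
  have "pcompose Q R - P * pcompose Q1 R - R ^ j * R * pcompose Q2 R
      - (R ^ j - polyX ^ j) * [:coeff Q j:] \<in> I (Suc j)"
    using dvd \<open>j < p\<close>
    by (intro ideal2_diff ideal2_mult_right ideal2_dvd1[OF dvd] I_mono[OF P_in_I] Rj I_mult[OF Ri R1])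
      auto
  also have "pcompose Q R - P * pcompose Q1 R - R ^ j * R * pcompose Q2 R
      - (R ^ j - polyX ^ j) * [:coeff Q j:] = polyX ^ j * [:coeff Q j:]"
    unfolding comp by (simp only: algebra_simps)
  finally obtain u v where uv: "polyX ^ j * [:coeff Q j:] = F * u + polyX ^ Suc j * v"
    by (rule ideal2E)
  \<comment> \<open>Below degree \<open>p\<close>, multiples of \<open>F = X ^ p + p * B\<close>
    have coefficients divisible by \<open>p\<close>, which contradicts the choice of
    \<open>j\<close>.\<close>
  have "coeff Q j = coeff (polyX ^ j * [:coeff Q j:]) j"
    by (subst coeff_polyX_power_mult) simp
  also have "\<dots> = coeff (polyX ^ p * u + P * (B * u) + polyX ^ Suc j * v) j"
    unfolding uv by (simp add: F_def algebra_simps)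
  also have "\<dots> = of_nat p * coeff (B * u) j"
    using \<open>j < p\<close> by (simp add: coeff_polyX_power_mult of_nat_poly del: power_Suc)
  finally show False using j by simp
qed

end

subsection \<open>Roots of trinomials\<close>

context eisenstein_poly
begin

lemma mem_I_of_coeffs:
  assumes "n \<le> p" "\<And>i. i < n \<Longrightarrow> of_nat p dvd coeff Q i"
  shows "Q \<in> I n"
proof -
  have "P dvd poly_cutoff n Q"
    using assms(2) of_nat_poly_dvd_iff[of p "poly_cutoff n Q"] by (simp add: coeff_poly_cutoff)
  then obtain Q1 where "poly_cutoff n Q = P * Q1" by (elim dvdE)
  moreover have "Q = poly_cutoff n Q + polyX ^ n * poly_shift n Q"
    by (rule poly_eqI) (simp add: coeff_polyX_power_mult coeff_poly_cutoff coeff_poly_shift)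
  moreover have "P * Q1 + polyX ^ n * poly_shift n Q \<in> I n"
    using assms(1) by (intro ideal2_add ideal2_mult_right I_mono[OF P_in_I] X_in_I) auto
  ultimately show ?thesis by simp
qed

text \<open>With \<open>Y = X V\<close>, adding \<open>X ^ (m + 1) s\<close> means adding
  \<open>Z\<close> to \<open>V\<close>. The linear term of the \<open>l\<close>-th power gives
  \<open>l c s p X ^ (l + m)\<close>; the bound on \<open>p * m\<close> pushes
  \<open>(X Z) ^ p\<close> to higher order, and \<open>l < p\<close> does so for the terms with
  \<open>p X ^ (p + m)\<close>.\<close>

lemma trinomial_step:
  assumes V: "polyX dvd V - 1" and m: "Suc l + m \<le> p * m" "m \<ge> 1" and l: "1 \<le> l" "l < p"
    and Z: "Z = polyX ^ m * s"
  shows "((polyX * (V + Z)) ^ p + P * (c * (polyX * (V + Z)) ^ l) + P * d)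
      - ((polyX * V) ^ p + P * (c * (polyX * V) ^ l) + P * d)
      - P * polyX ^ (l + m) * (of_nat l * c * s) \<in> I (Suc (p + l + m))"
proof -
  obtain S where S: "(V + Z) ^ p = V ^ p + Z ^ p + P * V ^ (p - 1) * Z + P * (Z\<^sup>2 * S)"
    using prime_p by (rule power_prime_add)
  obtain S' where "(V + Z) ^ Suc (l - 1) = V ^ Suc (l - 1) + of_nat (Suc (l - 1)) * V ^ (l - 1) * Z + Z\<^sup>2 * S'"
    by (rule power_add_first_order)
  then have S': "(V + Z) ^ l = V ^ l + of_nat l * V ^ (l - 1) * Z + Z\<^sup>2 * S'"
    using l by simp
  obtain W where "V ^ (l - 1) - 1 = polyX * W"
    using dvd_power_diff_1[OF V, of "l - 1"] by (elim dvdE)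
  then have W: "V ^ (l - 1) = 1 + polyX * W" by (simp add: diff_eq_eq add.commute)
  have "((polyX * (V + Z)) ^ p + P * (c * (polyX * (V + Z)) ^ l) + P * d)
      - ((polyX * V) ^ p + P * (c * (polyX * V) ^ l) + P * d)
      - P * polyX ^ (l + m) * (of_nat l * c * s)
    = polyX ^ (p + p * m) * s ^ p + P * polyX ^ (p + m) * (s * (V ^ (p - 1) + Z * S))
      + P * polyX ^ (l + m + 1) * (of_nat l * c * W * s) + P * polyX ^ (l + m + m) * (c * s\<^sup>2 * S')"
    unfolding power_mult_distrib S S' W
    by (simp add: Z algebra_simps power_add power_mult power_mult_distrib power2_eq_square)
  also have "\<dots> \<in> I (Suc (p + l + m))"
    using m l by (intro ideal2_add X_in_I PX1_in_I) auto
  finally show ?thesis .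
qed

text \<open>Here the leading change is the linear term of the \<open>p\<close>-th power itself, with
  its factor \<open>p\<close> from the binomial coefficient; the stronger bound on
  \<open>p * m\<close> keeps \<open>(X Z) ^ p\<close> behind it.\<close>

lemma binomial_step:
  assumes V: "polyX dvd V - 1" and m: "p + m + 1 \<le> p * m" "m \<ge> 1"
    and Z: "Z = polyX ^ m * s"
  shows "((polyX * (V + Z)) ^ p + P * d) - ((polyX * V) ^ p + P * d)
      - P * polyX ^ (p + m) * s \<in> I (Suc (p + p + m))"
proof -
  obtain S where S: "(V + Z) ^ p = V ^ p + Z ^ p + P * V ^ (p - 1) * Z + P * (Z\<^sup>2 * S)"
    using prime_p by (rule power_prime_add)
  obtain W where "V ^ (p - 1) - 1 = polyX * W"
    using dvd_power_diff_1[OF V, of "p - 1"] by (elim dvdE)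
  then have W: "V ^ (p - 1) = 1 + polyX * W" by (simp add: diff_eq_eq add.commute)
  have "((polyX * (V + Z)) ^ p + P * d) - ((polyX * V) ^ p + P * d) - P * polyX ^ (p + m) * s
    = polyX ^ (p + p * m) * s ^ p + P * polyX ^ (p + m + 1) * (W * s)
      + P * polyX ^ (p + m + m) * (s\<^sup>2 * S)"
    unfolding power_mult_distrib S W
    by (simp add: Z algebra_simps power_add power_mult power_mult_distrib power2_eq_square)
  also have "\<dots> \<in> I (Suc (p + p + m))"
    using m by (intro ideal2_add X_in_I PX1_in_I) auto
  finally show ?thesis .
qed

section \<open>Starting values and the resulting roots\<close>

lemma of_nat_unit:
  assumes "0 < l" "l < p"
  shows "(of_nat l :: 'p padic_int) dvd 1"
proof -
  have "\<not> p dvd l" using assms by (auto dest: dvd_imp_le)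
  then have "\<not> of_nat p dvd (of_nat l :: 'p padic_int)"
    using padic_int_dvd_pow_iff[of 1 "of_nat l :: 'p padic_int"]
      Rep_padic_int_of_int[of "int l" 1, where 'p = 'p]
    by (simp add: p_eq zmod_int[symmetric] mod_eq_0_iff_dvd)
  then show ?thesis unfolding p_eq padic_int_unit_iff .
qed

text \<open>This is \<open>hensel\<close> with \<open>M = l + k - 1\<close> and the unit
  \<open>l * c\<close>. The bound on \<open>p * (k - 1)\<close> is that of
  \<open>trinomial_step\<close> for the first correction, and it persists for the later
  ones.\<close>

lemma trinomial_root:
  assumes l: "1 \<le> l" "l < p" and k: "k \<ge> 2" "l + k \<le> p * (k - 1)"
    and Y0: "polyX ^ 2 dvd Y0 - polyX" and c: "c dvd 1"
    and start: "Y0 ^ p + P * ([:c:] * Y0 ^ l) + P * [:d:] \<in> I (p + l + (k - 1))"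
  obtains R where "F dvd pcompose (polyX ^ p + P * ([:c:] * polyX ^ l) + P * [:d:]) R"
    "R - polyX \<in> I 2"
proof -
  let ?G = "polyX ^ p + P * ([:c:] * polyX ^ l) + P * [:d:]"
  have G: "pcompose ?G Y = Y ^ p + P * ([:c:] * Y ^ l) + P * [:d:]" for Y
    by (simp add: pcompose_add pcompose_mult pcompose_power pcompose_smult)
  have "of_nat l * c dvd 1"
    using c of_nat_unit[of l] l by (simp add: is_unit_mult_iff)
  then obtain c' where c': "1 = of_nat l * c * c'" by (elim dvdE)
  have unit: "of_nat l * [:c:] * [:c':] = 1"
    using c' by (simp add: of_nat_poly one_pCons) (metis mult.commute)
  have step: "pcompose ?G (Y + polyX ^ (k + n) * s) - pcompose ?G Y
      - P * polyX ^ (l + (k - 1) + n) * (of_nat l * [:c:] * s) \<in> I (Suc (l + (k - 1) + p + n))"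
    if Y_cong: "polyX ^ k dvd Y - Y0" for n Y s
  proof -
    obtain V where V: "Y = polyX * V" "polyX dvd V - 1"
      using polyX_factor[OF Y_cong k(1) Y0] by blast
    define m where "m = k - 1 + n"
    have "k + n = Suc m" using k by (simp add: m_def)
    then have Y: "polyX * V + polyX ^ (k + n) * s = polyX * (V + polyX ^ m * s)"
      by (simp only: power_Suc distrib_left mult.assoc)
    have "p * m = p * (k - 1) + p * n" by (simp add: m_def algebra_simps)
    moreover have "n \<le> p * n" using p_ge_3 by simp
    ultimately have "Suc l + m \<le> p * m" using k unfolding m_def by linarith
    moreover have "m \<ge> 1" using k by (simp add: m_def)
    ultimately show ?thesis
      using trinomial_step[OF V(2) _ _ _ _ refl, of l m s "[:c:]" "[:d:]"] l
      unfolding G V(1) Y by (simp add: m_def ac_simps)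
  qed
  have "l + (k - 1) + p = p + l + (k - 1)" by simp
  then have "pcompose ?G Y0 \<in> I (l + (k - 1) + p)"
    using start by (simp only: G)
  from hensel[OF k(1) this unit step] obtain R where R: "F dvd pcompose ?G R" "R - Y0 \<in> I 2"
    by blast
  have "(R - Y0) + (Y0 - polyX) \<in> I 2"
    by (rule ideal2_add[OF R(2) ideal2_dvd2[OF Y0]])
  then show ?thesis using that[OF R(1)] by simp
qed

text \<open>The start \<open>X\<close> suffices: modulo \<open>F\<close> its value is
  \<open>p * (c X ^ l + d - B)\<close>, whose second factor has order at least \<open>l + 1\<close>.
  The bound \<open>l + 2 <= p\<close> is the one required for \<open>k = 2\<close>.\<close>

lemma root_lt_p_minus_1:
  assumes l: "1 \<le> l" "l + 2 \<le> p" and c: "c dvd 1"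
    and low: "\<And>i. 1 \<le> i \<Longrightarrow> i < l \<Longrightarrow> of_nat p dvd coeff B i"
    and cl: "of_nat p dvd c - coeff B l" and d: "of_nat p dvd d - coeff B 0"
  obtains R where "F dvd pcompose (polyX ^ p + P * ([:c:] * polyX ^ l) + P * [:d:]) R"
    "R - polyX \<in> I 2"
proof (rule trinomial_root[where k = 2 and ?Y0.0 = polyX])
  let ?D = "[:c:] * polyX ^ l + [:d:] - B"
  have "of_nat p dvd coeff ?D i" if "i < Suc l" for i
    using that low[of i] cl d l
    by (cases "i = 0 \<or> i = l") (auto simp: polyX_power coeff_pCons split: nat.splits)
  then have "?D \<in> I (Suc l)" using l by (intro mem_I_of_coeffs) auto
  then have "F * 1 + P * ?D \<in> I (p + l + (2 - 1))"
    using P_in_I by (intro ideal2_add F_in_I I_mult[of P p ?D "Suc l"]) auto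
  also have "F * 1 + P * ?D = polyX ^ p + P * ([:c:] * polyX ^ l) + P * [:d:]"
    unfolding F_def by (simp add: algebra_simps)
  finally show "\<dots> \<in> I (p + l + (2 - 1))" .
qed (use l c that in auto)

text \<open>With \<open>k = 3\<close> the start must reach order \<open>2 p + 1\<close>. The terms
  of order \<open>2 p\<close> in the value at \<open>X + t X ^ 2\<close> add up to
  \<open>p ^ 2\<close> times the expression in \<open>t\<close>, which is why that expression must
  vanish modulo \<open>p\<close>.\<close>

lemma root_p_minus_1:
  assumes c: "c dvd 1"
    and D: "[:c:] * polyX ^ (p - 1) + [:d:] - B = P * E"
    and t: "of_nat p dvd coeff E 0 + t ^ p * coeff B 0 ^ 2 + c * t * coeff B 0"
  obtains R where "F dvd pcompose (polyX ^ p + P * ([:c:] * polyX ^ (p - 1)) + P * [:d:]) R"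
    "R - polyX \<in> I 2"
proof (rule trinomial_root[where k = 3 and ?Y0.0 = "polyX + [:t:] * polyX ^ 2"])
  let ?t = "[:t:]" and ?c = "[:c:]" and ?d = "[:d:]" and ?e = "[:coeff E 0:]"
  obtain U where U: "E = ?e + polyX * U" by (rule poly_split_polyX)
  have "[:of_nat p:] dvd [:coeff E 0 + t ^ p * coeff B 0 ^ 2 + c * t * coeff B 0:]"
    using t by (simp only: const_poly_dvd_const_poly_iff)
  also have "[:coeff E 0 + t ^ p * coeff B 0 ^ 2 + c * t * coeff B 0:] = ?e + ?t ^ p * b0\<^sup>2 + ?c * ?t * b0"
    by (simp add: b0_def poly_const_pow power2_eq_square)
  finally obtain w where w: "?e + ?t ^ p * b0\<^sup>2 + ?c * ?t * b0 = P * w"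
    unfolding of_nat_poly[symmetric] by (elim dvdE)
  obtain S where S: "(1 + ?t * polyX) ^ p = 1 ^ p + (?t * polyX) ^ p + P * 1 ^ (p - 1) * (?t * polyX)
      + P * ((?t * polyX)\<^sup>2 * S)"
    using prime_p by (rule power_prime_add)
  obtain S' where "(1 + ?t * polyX) ^ Suc (p - 2) = 1 ^ Suc (p - 2)
      + of_nat (Suc (p - 2)) * 1 ^ (p - 2) * (?t * polyX) + (?t * polyX)\<^sup>2 * S'"
    by (rule power_add_first_order)
  moreover have "Suc (p - 2) = p - 1" using p_ge_3 by simp
  ultimately have S': "(1 + ?t * polyX) ^ (p - 1) = 1 + (P - 1) * (?t * polyX) + (?t * polyX)\<^sup>2 * S'"
    using p_ge_3 by (simp add: of_nat_diff)
  define A :: "'p padic_int poly" where "A = polyX ^ p"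
  have A: "A + P * b0 \<in> I (Suc p)" "A - P * b0 \<in> I p"
  proof -
    show "A + P * b0 \<in> I (Suc p)" unfolding A_def by (rule Xp_in_I)
    show "A - P * b0 \<in> I p"
      using X_in_I[of p p 1] unfolding A_def by (intro ideal2_diff ideal2_mult_right P_in_I) simp
  qed
  have Xp1: "polyX * polyX ^ (p - 1) = A"
    using p_ge_3 by (simp add: A_def flip: power_Suc)
  have X0: "polyX + ?t * polyX ^ 2 = polyX * (1 + ?t * polyX)"
    by (simp add: algebra_simps power2_eq_square)
  have "(polyX + ?t * polyX ^ 2) ^ p + P * (?c * (polyX + ?t * polyX ^ 2) ^ (p - 1)) + P * ?d
    = A * (1 + ?t * polyX) ^ p + P * (?c * polyX ^ (p - 1) * (1 + ?t * polyX) ^ (p - 1)) + P * ?d"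
    unfolding X0 power_mult_distrib by (simp only: A_def mult_ac)
  also have "\<dots> = A + P * (?c * polyX ^ (p - 1) + ?d)
      + ?t ^ p * (A * A) + P * polyX ^ (p + 1) * (?t + ?t\<^sup>2 * polyX * S)
      + P * (?c * (P - 1) * ?t) * (polyX * polyX ^ (p - 1))
      + P * ?c * ?t\<^sup>2 * S' * polyX * (polyX * polyX ^ (p - 1))"
    unfolding S S' power_mult_distrib A_def[symmetric]
    by (simp only: algebra_simps power2_eq_square power_one mult_1_left mult_1_right power_add power_one_right A_def)
  also have "?c * polyX ^ (p - 1) + ?d = B + P * (?e + polyX * U)"
    using D U by (simp add: algebra_simps)
  \<comment> \<open>Regrouping by order: \<open>A * A\<close> is traded for \<open>p^2 b0^2\<close>
    through a difference of squares, and \<open>- p c t A\<close> for \<open>p^2 c t b0\<close>.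
    Besides the multiple of \<open>F\<close>, only the last summand is not visibly of order
    \<open>2 p + 1\<close>; there the condition on \<open>t\<close> supplies a third factor
    \<open>p\<close>.\<close>
  also have "A + P * (B + P * (?e + polyX * U))
      + ?t ^ p * (A * A) + P * polyX ^ (p + 1) * (?t + ?t\<^sup>2 * polyX * S)
      + P * (?c * (P - 1) * ?t) * (polyX * polyX ^ (p - 1))
      + P * ?c * ?t\<^sup>2 * S' * polyX * (polyX * polyX ^ (p - 1))
    = F * 1 + P ^ 2 * polyX ^ 1 * U + ?t ^ p * ((A + P * b0) * (A - P * b0))
      + P * polyX ^ (p + 1) * (?t + ?t\<^sup>2 * polyX * S) + P ^ 2 * polyX ^ p * (?c * ?t)
      - P * (A + P * b0) * (?c * ?t) + P * polyX ^ (p + 1) * (?c * ?t\<^sup>2 * S')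
      + P ^ 2 * (?e + ?t ^ p * b0\<^sup>2 + ?c * ?t * b0)"
    unfolding Xp1 F_def A_def[symmetric]
    by (simp only: algebra_simps power2_eq_square power_add power_one_right A_def mult_1_left mult_1_right)
  also have "\<dots> \<in> I (p + (p - 1) + (3 - 1))"
  proof -
    have "P ^ 2 * (?e + ?t ^ p * b0\<^sup>2 + ?c * ?t * b0) = P ^ 3 * polyX ^ 0 * w"
      unfolding w by (simp add: power_numeral_reduce)
    then show ?thesis
      using p_ge_3
      by (simp only:)
        (intro ideal2_add ideal2_diff F_in_I PX_in_I PX1_in_I ideal2_mult_left[OF I_mult[OF A]]
          ideal2_mult_right[OF I_mult[OF P_in_I A(1)]]; simp)
  qed
  finally show "(polyX + ?t * polyX ^ 2) ^ p + P * (?c * (polyX + ?t * polyX ^ 2) ^ (p - 1)) + P * ?d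
      \<in> I (p + (p - 1) + (3 - 1))" .
qed (use c p_ge_3 that in \<open>auto simp: dvd_smult\<close>)

text \<open>Corrections begin at \<open>X ^ 3\<close> with leading effect
  \<open>p X ^ (p + 2)\<close>, so the start must reach order \<open>2 p + 2\<close>. The choice of
  \<open>y\<close> removes the linear term but creates \<open>y ^ p X ^ (2 p)\<close>, which up to
  higher order is \<open>y ^ p p^2 b0^2\<close> and is absorbed by \<open>d\<close>.\<close>

lemma root_type_0:
  assumes B: "B = b0 + P * (polyX * U)" and y: "y * coeff B 0 = - coeff U 0"
    and d: "of_nat p ^ 2 dvd d - (coeff B 0 - of_nat p * y ^ p * coeff B 0 ^ 2)"
  obtains R where "F dvd pcompose (polyX ^ p + P * [:d:]) R" "R - polyX \<in> I 2"
proof -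
  let ?G = "polyX ^ p + P * [:d:]" and ?y = "[:y:]"
  let ?Y0 = "polyX + ?y * polyX ^ 2"
  have G: "pcompose ?G Y = Y ^ p + P * [:d:]" for Y
    by (simp add: pcompose_add pcompose_mult pcompose_power pcompose_smult)
  have Y0: "polyX ^ 2 dvd ?Y0 - polyX" by (simp add: dvd_smult)
  have step: "pcompose ?G (Y + polyX ^ (3 + n) * s) - pcompose ?G Y
      - P * polyX ^ (p + 2 + n) * (1 * s) \<in> I (Suc (p + 2 + p + n))"
    if Y_cong: "polyX ^ 3 dvd Y - ?Y0" for n Y s
  proof -
    obtain V where V: "Y = polyX * V" "polyX dvd V - 1"
      using polyX_factor[OF Y_cong, of thesis] Y0 by auto
    define m where "m = 2 + n"
    have "3 + n = Suc m" by (simp add: m_def)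
    then have Y: "polyX * V + polyX ^ (3 + n) * s = polyX * (V + polyX ^ m * s)"
      by (simp only: power_Suc distrib_left mult.assoc)
    have "p * m = 2 * p + p * n" by (simp add: m_def algebra_simps)
    moreover have "n \<le> p * n" using p_ge_3 by simp
    \<comment> \<open>Already for \<open>m = 2\<close> this reads \<open>p + 3 <= 2 p\<close> and
      needs \<open>p >= 3\<close>.\<close>
    ultimately have "p + m + 1 \<le> p * m" using p_ge_3 unfolding m_def by linarith
    then show ?thesis
      using binomial_step[OF V(2) _ _ refl, of m s "[:d:]"] unfolding G V(1) Y
      by (simp add: m_def ac_simps)
  qed
  have start: "pcompose ?G ?Y0 \<in> I (p + 2 + p)"
  proof -
    define u where "u = [:coeff U 0:]"
    obtain U' where U': "U = u + polyX * U'" unfolding u_def by (rule poly_split_polyX)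
    have yb: "?y * b0 = - u" using y by (simp add: b0_def u_def mult.commute)
    obtain e where e: "d - (coeff B 0 - of_nat p * y ^ p * coeff B 0 ^ 2) = of_nat p ^ 2 * e"
      using d by (elim dvdE)
    have "[:d:] = [:(coeff B 0 - of_nat p * y ^ p * coeff B 0 ^ 2) + of_nat p ^ 2 * e:]"
      using e by (simp add: algebra_simps)
    also have "\<dots> = b0 - P * ?y ^ p * b0\<^sup>2 + P\<^sup>2 * [:e:]"
      by (simp add: b0_def poly_const_pow power2_eq_square of_nat_poly)
    finally have dd: "[:d:] = b0 - P * ?y ^ p * b0\<^sup>2 + P\<^sup>2 * [:e:]" .
    obtain S where S: "(1 + ?y * polyX) ^ p = 1 ^ p + (?y * polyX) ^ p
        + P * 1 ^ (p - 1) * (?y * polyX) + P * ((?y * polyX)\<^sup>2 * S)"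
      using prime_p by (rule power_prime_add)
    define A :: "'p padic_int poly" where "A = polyX ^ p"
    have F: "A + P * b0 = F - P\<^sup>2 * (polyX * U)"
      unfolding F_def A_def[symmetric] by (subst B) (simp add: algebra_simps power2_eq_square)
    have A: "A - P * b0 \<in> I p"
      using X_in_I[of p p 1] unfolding A_def by (intro ideal2_diff ideal2_mult_right P_in_I) simp
    have X0: "?Y0 = polyX * (1 + ?y * polyX)"
      by (simp add: algebra_simps power2_eq_square)
    \<comment> \<open>Cancellation of the linear term: by \<open>yb\<close> the constant coefficient
      of \<open>U\<close> disappears, which gains a factor \<open>X\<close>.\<close>
    have U2: "P\<^sup>2 * (polyX * U) + P\<^sup>2 * (?y * b0) * polyX = P\<^sup>2 * polyX\<^sup>2 * U'"
      unfolding yb by (subst U') (simp add: algebra_simps power2_eq_square del: mult_pCons_left mult_pCons_right)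
    have "pcompose ?G ?Y0 = A * (1 + ?y * polyX) ^ p + P * [:d:]"
      unfolding G X0 power_mult_distrib A_def ..
    also have "\<dots> = (A + P * b0) + P * ?y * polyX * (A + P * b0) - P\<^sup>2 * (?y * b0) * polyX
        + ?y ^ p * (A + P * b0) * (A - P * b0) + P * polyX ^ (p + 2) * (?y\<^sup>2 * S) + P * P\<^sup>2 * [:e:]"
      unfolding S power_mult_distrib A_def[symmetric] dd
      by (simp only: algebra_simps power2_eq_square power_one mult_1_left mult_1_right power_add A_def)
    \<comment> \<open>For type \<open>0\<close>, \<open>A + P * b0\<close> is a multiple of
      \<open>p^2 X\<close> modulo \<open>F\<close>, which is much sharper than
      \<open>Xp_in_I\<close>.\<close>
    also have "\<dots> = F * (1 + P * ?y * polyX + ?y ^ p * (A - P * b0))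
        - (P\<^sup>2 * (polyX * U) + P\<^sup>2 * (?y * b0) * polyX)
        - P ^ 3 * polyX ^ 2 * (?y * U) - P ^ 2 * polyX ^ 1 * (U * ?y ^ p) * (A - P * b0)
        + P * polyX ^ (p + 2) * (?y\<^sup>2 * S) + P ^ 3 * polyX ^ 0 * [:e:]"
      unfolding F
      by (simp only: algebra_simps power2_eq_square power3_eq_cube power_one_right
          mult_1_left mult_1_right power_0)
    also have "\<dots> \<in> I (p + 2 + p)"
      unfolding U2
      using p_ge_3 by (intro ideal2_add ideal2_diff F_in_I PX_in_I PX1_in_I I_mult[OF PX_in_I[OF order_refl] A]) auto
    finally show ?thesis .
  qed
  obtain R where R: "F dvd pcompose ?G R" "R - ?Y0 \<in> I 2"
    by (rule hensel[where k = 3 and M = "p + 2" and c = 1 and c' = 1 and G = ?G, OF _ start _ step]) auto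
  have "(R - ?Y0) + (?Y0 - polyX) \<in> I 2"
    by (rule ideal2_add[OF R(2) ideal2_dvd2[OF Y0]])
  then show ?thesis using that[OF R(1)] by simp
qed

end

subsection \<open>Passage to the p-adic numbers\<close>

lemma fract_poly_const: "fract_poly [:a:] = [:to_fract a:]"
  by (rule poly_eqI) (simp add: coeff_map_poly coeff_pCons split: nat.split)

lemma fract_poly_pcompose:
  "fract_poly (pcompose q r) = pcompose (fract_poly q) (fract_poly r)"
  by (induction q) (simp_all add: pcompose_pCons map_poly_pCons fract_poly_const)

lemma degree_fract_poly: "degree (fract_poly q) = degree q"
  by (rule degree_map_poly) simp

lemma vp_to_fract:
  assumes "w dvd 1"
  shows "vp (to_fract (of_nat CARD('p) ^ k * w) :: 'p::prime_card padic) = ereal (real k)"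
proof -
  have "to_fract (of_nat CARD('p) ^ k * w) = (padic_p :: 'p padic) powi int k * to_fract w"
    by (simp add: to_fract_power padic_p_eq_to_fract)
  moreover have "to_fract (of_nat CARD('p) ^ k * w) \<noteq> 0"
    using assms padic_p_nonzero[where 'p = 'p] by auto
  ultimately show ?thesis
    using padic_ord_eq[OF assms, of "int k"] by (simp add: vp_def del: to_fract_mult)
qed

lemma vp_to_fract_ge_iff:
  fixes x :: "'p::prime_card padic_int"
  shows "vp (to_fract x) \<ge> ereal (real n) \<longleftrightarrow> of_nat CARD('p) ^ n dvd x"
proof (cases "x = 0")
  case True
  then show ?thesis by (simp add: vp_def)
next
  case False
  then obtain k w where w: "w dvd 1" and x: "x = of_nat CARD('p) ^ k * w"
    by (rule padic_int_decomp)
  have "of_nat CARD('p) ^ n dvd x \<longleftrightarrow> n \<le> k"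
  proof
    assume n: "of_nat CARD('p) ^ n dvd x"
    show "n \<le> k"
    proof (rule ccontr)
      assume "\<not> n \<le> k"
      then have "of_nat CARD('p) ^ k * of_nat CARD('p) dvd x"
        using n power_le_dvd[of _ n x "Suc k"] by (simp add: mult.commute)
      then have "of_nat CARD('p) dvd w"
        using padic_p_nonzero[where 'p = 'p] by (simp add: x)
      then show False using w padic_int_unit_iff by blast
    qed
  qed (simp add: x le_imp_power_dvd)
  then show ?thesis unfolding x vp_to_fract[OF w] by simp
qed

lemma vp_to_fract_eq_iff:
  fixes x :: "'p::prime_card padic_int"
  shows "vp (to_fract x) = ereal (real n) \<longleftrightarrow>
    of_nat CARD('p) ^ n dvd x \<and> \<not> of_nat CARD('p) ^ Suc n dvd x"
proof (cases "x = 0")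
  case True
  then show ?thesis by (simp add: vp_def)
next
  case False
  then obtain k w where w: "w dvd 1" and x: "x = of_nat CARD('p) ^ k * w"
    by (rule padic_int_decomp)
  show ?thesis
    unfolding vp_to_fract_ge_iff[symmetric] unfolding x vp_to_fract[OF w] by auto
qed

lemma of_int_eq_to_fract: "of_int j = to_fract (of_int j :: 'a::idom)"
  by (cases j rule: int_cases2) (simp_all add: to_fract_def of_nat_fract)

lemma of_nat_eq_to_fract: "of_nat j = to_fract (of_nat j :: 'a::idom)"
  by (simp add: to_fract_def of_nat_fract)

lemma padic_cong_to_fract:
  fixes x y :: "'p::prime_card padic_int"
  shows "padic_cong n (to_fract x) (to_fract y) \<longleftrightarrow> of_nat CARD('p) ^ n dvd x - y"
proof -
  have "padic_cong n (to_fract x) (to_fract y) \<longleftrightarrow>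
      (\<exists>z. to_fract (x - y) = to_fract (of_nat CARD('p) ^ n * z))"
    by (simp add: padic_cong_def Zp_def padic_p_eq_to_fract to_fract_power)
  then show ?thesis by (simp only: to_fract_eq_iff dvd_def)
qed

lemma residue_to_fract:
  fixes x :: "'p::prime_card padic_int"
  assumes "\<not> of_nat CARD('p) ^ n dvd x"
  shows "residue n (to_fract x) \<ge> 1" "of_nat CARD('p) ^ n dvd x - of_int (residue n (to_fract x))"
proof -
  have "\<not> padic_cong n (to_fract x) 0"
    using assms padic_cong_to_fract[of n x 0] by simp
  then have "\<exists>!j. 1 \<le> j \<and> j \<le> int CARD('p) ^ n - 1 \<and> padic_cong n (to_fract x) (of_int j)"
    by (intro residue_ex1) (auto simp: Zp_def)
  from theI'[OF this] show "residue n (to_fract x) \<ge> 1"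
    "of_nat CARD('p) ^ n dvd x - of_int (residue n (to_fract x))"
    by (simp_all add: residue_def of_int_eq_to_fract padic_cong_to_fract)
qed

text \<open>Divisibility by \<open>p\<close> passes to the residue, and cancelling \<open>p\<close>
  lowers the modulus by one power: residues modulo \<open>p ^ 2\<close> and \<open>p ^ 3\<close>
  determine \<open>d\<close> modulo \<open>p\<close> and \<open>p ^ 2\<close>.\<close>

lemma residue_p_mult:
  fixes b :: "'p::prime_card padic_int"
  assumes "\<not> of_nat CARD('p) dvd b" "n > 0"
  obtains d where "of_int (residue (Suc n) (to_fract (of_nat CARD('p) * b))) = of_nat CARD('p) * d"
    "of_nat CARD('p) ^ n dvd d - b"
proof -
  have "\<not> of_nat CARD('p) ^ Suc n dvd of_nat CARD('p) * b"
    using assms padic_p_nonzero[where 'p = 'p] dvd_trans[of "of_nat CARD('p)" "of_nat CARD('p) ^ n" b]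
    by auto
  note res = residue_to_fract(2)[OF this]
  define j where "j = residue (Suc n) (to_fract (of_nat CARD('p) * b))"
  obtain q where "of_nat CARD('p) * b - of_int j = of_nat CARD('p) ^ Suc n * q"
    using res[folded j_def] by (elim dvdE)
  then have "of_int j = of_nat CARD('p) * (b - of_nat CARD('p) ^ n * q)"
    by (simp add: algebra_simps)
  then show ?thesis unfolding j_def by (rule that) simp
qed

text \<open>Dividing by the least power of \<open>p\<close> occurring in the coefficients gives an
  integral polynomial with a unit coefficient, to which \<open>pcompose_not_dvd\<close>
  applies.\<close>

lemma padic_poly_scale_primitive:
  fixes q :: "'p::prime_card padic poly"
  assumes "q \<noteq> 0"
  obtains c Q i where "c \<noteq> 0" "smult c q = fract_poly Q" "\<not> of_nat CARD('p) dvd coeff Q i"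
proof -
  define A where "A = {i. coeff q i \<noteq> 0}"
  define k where "k i = padic_ord (coeff q i)" for i
  have "\<exists>w. w dvd 1 \<and> coeff q i = padic_p powi k i * to_fract w" if "i \<in> A" for i
  proof -
    have "coeff q i \<noteq> 0" using that by (simp add: A_def)
    then obtain m w where w: "w dvd 1" "coeff q i = padic_p powi m * to_fract w"
      by (rule padic_decomp)
    then have "k i = m" unfolding k_def w(2) by (intro padic_ord_eq)
    then show ?thesis using w by blast
  qed
  then obtain w where kw: "\<And>i. i \<in> A \<Longrightarrow> w i dvd 1"
    "\<And>i. i \<in> A \<Longrightarrow> coeff q i = padic_p powi k i * to_fract (w i)"
    by metis
  have "finite A" unfolding A_def by (rule finite_subset[of _ "{..degree q}"]) (auto intro: le_degree)
  moreover have "degree q \<in> A" using assms by (simp add: A_def)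
  then have "A \<noteq> {}" by blast
  ultimately obtain i where i: "i \<in> A" "\<And>j. j \<in> A \<Longrightarrow> k i \<le> k j"
    using arg_min_if_finite[of A k] by (metis not_less)
  define c where "c = (padic_p :: 'p padic) powi (- k i)"
  have "\<exists>z. c * coeff q j = to_fract z" for j
  proof (cases "j \<in> A")
    case True
    have "c * coeff q j = padic_p powi (k j - k i) * to_fract (w j)"
      using kw(2)[OF True] power_int_add[of "padic_p :: 'p padic" "- k i" "k j"] by (simp add: c_def)
    also have "padic_p powi (k j - k i) = (padic_p :: 'p padic) ^ nat (k j - k i)"
      using i(2)[OF True] by (simp add: power_int_def)
    also have "\<dots> * to_fract (w j) = to_fract (of_nat CARD('p) ^ nat (k j - k i) * w j)"
      by (simp add: to_fract_power padic_p_eq_to_fract)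
    finally show ?thesis ..
  next
    case False
    then show ?thesis by (auto simp: A_def intro: exI[of _ 0])
  qed
  then obtain z where z: "\<And>j. c * coeff q j = to_fract (z j)" by metis
  define Q where "Q = (\<Sum>j\<le>degree q. monom (z j) j)"
  have Q: "coeff Q j = z j" for j
  proof -
    have "z j = 0" if "degree q < j" using z[of j] that by (simp add: coeff_eq_0)
    then show ?thesis by (auto simp: Q_def coeff_sum)
  qed
  have "smult c q = fract_poly Q" by (rule poly_eqI) (simp add: coeff_map_poly Q z)
  moreover have "c \<noteq> 0" by (simp add: c_def)
  moreover have "to_fract (z i) = to_fract (w i)"
    using kw(2)[OF i(1)] power_int_add[of "padic_p :: 'p padic" "- k i" "k i"]
    by (simp add: c_def mult.assoc[symmetric] flip: z)
  then have "\<not> of_nat CARD('p) dvd coeff Q i"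
    using kw(1)[OF i(1)] padic_int_unit_iff[of "w i"] by (simp add: Q)
  ultimately show ?thesis using that by blast
qed

section \<open>From roots modulo \<open>F\<close> to isomorphic quotients\<close>

context eisenstein_poly
begin

text \<open>Since \<open>F\<close> is monic, division with remainder already takes place over the
  p-adic integers, and the remainder decides divisibility over both rings.\<close>

lemma fract_poly_dvd_iff: "fract_poly F dvd fract_poly h \<longleftrightarrow> F dvd h"
proof
  assume dvd: "fract_poly F dvd fract_poly h"
  obtain q r where qr: "h = F * q + r" "degree r < p" by (rule division)
  then have "fract_poly F dvd fract_poly r"
    using dvd by (simp add: dvd_add_right_iff)
  then have "r = 0"
    using qr(2) dvd_imp_degree_le[of "fract_poly F" "fract_poly r"]
    by (auto simp: degree_fract_poly degree_F)
  then show "F dvd h" by (simp add: qr)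
qed (rule fract_poly_dvd)

text \<open>The root gives the homomorphism. A nonzero \<open>q\<close> of small degree in its
  kernel would, scaled to a primitive polynomial, contradict
  \<open>pcompose_not_dvd\<close>.\<close>

lemma quot_equiv_of_root:
  assumes "degree G = p" "F dvd pcompose G R" "R - polyX \<in> I 2"
  shows "fract_poly F \<sim>\<^sub>Q fract_poly G"
proof (rule quot_equivI[where r = "fract_poly R" and n = p])
  show "fract_poly F dvd pcompose (fract_poly G) (fract_poly R)"
    using assms(2) by (simp only: fract_poly_dvd_iff flip: fract_poly_pcompose)
next
  fix q :: "'p padic poly"
  assume q: "degree q < p" "fract_poly F dvd pcompose q (fract_poly R)"
  show "q = 0"
  proof (rule ccontr)
    assume "q \<noteq> 0"
    then obtain c Q i where Q: "c \<noteq> 0" "smult c q = fract_poly Q" "\<not> of_nat CARD('p) dvd coeff Q i"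
      by (rule padic_poly_scale_primitive)
    have "fract_poly F dvd pcompose (smult c q) (fract_poly R)"
      using q(2) by (simp add: pcompose_smult dvd_smult)
    then have "F dvd pcompose Q R"
      by (simp only: Q(2) fract_poly_dvd_iff flip: fract_poly_pcompose)
    moreover have "degree Q < p"
      using q(1) Q(1,2) by (metis degree_fract_poly degree_smult_eq)
    ultimately show False
      using pcompose_not_dvd[OF assms(3)] Q(3) unfolding p_eq by blast
  qed
qed (use assms(1) p_ge_3 in \<open>simp_all add: degree_fract_poly degree_F\<close>)

lemma trinomial_eq:
  "polyX ^ p + P * ([:c:] * polyX ^ l) + P * [:d:]
    = monom 1 p + monom (of_nat p * c) l + [:of_nat p * d:]"
  by (simp add: polyX_power of_nat_poly smult_monom mult.commute)

lemma degree_trinomial: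
  assumes "l < p"
  shows "degree (monom 1 p + monom (a :: 'p padic_int) l + [:b:]) = p"
proof -
  have "degree (monom a l + [:b:]) \<le> l"
    by (intro degree_add_le degree_monom_le) simp
  then show ?thesis
    using assms by (subst add.assoc, subst degree_add_eq_left) (auto simp: degree_monom_eq)
qed

lemma quot_equiv_trinomial:
  assumes "l < p" "F dvd pcompose (polyX ^ p + P * ([:c:] * polyX ^ l) + P * [:d:]) R"
    "R - polyX \<in> I 2"
  shows "fract_poly F \<sim>\<^sub>Q
    monom 1 p + monom (to_fract (of_nat p * c)) l + [:to_fract (of_nat p * d):]"
proof -
  have "fract_poly F \<sim>\<^sub>Q fract_poly (monom 1 p + monom (of_nat p * c) l + [:of_nat p * d:])"
    using assms unfolding trinomial_eq by (intro quot_equiv_of_root) (auto simp: degree_trinomial)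
  then show ?thesis by (simp add: map_poly_monom fract_poly_const)
qed

end

subsection \<open>Classification\<close>

text \<open>\<open>U\<close> is a scaling factor: \<open>F\<close> will be the monic polynomial
  whose roots are \<open>U\<close> times those of \<open>f\<close>. This serves to normalize the
  constant coefficient.\<close>

locale scaled_eisenstein =
  fixes f :: "'p::prime_card padic poly" and z :: "nat \<Rightarrow> 'p padic_int"
    and U :: "'p padic_int" and p :: nat
  assumes p_eq: "p = CARD('p)" and odd_p: "odd p"
    and degree_f: "degree f = p" and monic_f: "coeff f p = 1"
    and coeff_f: "\<And>i. i < p \<Longrightarrow> coeff f i = to_fract (of_nat p * z i)"
    and unit_z: "z 0 dvd 1" and unit_U: "U dvd 1"
begin

definition B :: "'p padic_int poly" where
  "B = (\<Sum>i<p. monom (U ^ (p - i) * z i) i)"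

lemma coeff_B: "coeff B i = (if i < p then U ^ (p - i) * z i else 0)"
  by (auto simp: B_def coeff_sum)

lemma p_gt_0: "p > 0"
  using odd_p by (cases p) auto

sublocale eisenstein_poly B p
proof
  have "degree B \<le> p - 1" by (rule degree_le) (auto simp: coeff_B)
  then show "degree B < p" using p_gt_0 by simp
  have "U ^ p dvd 1" using dvd_power_same[OF unit_U, of p] by simp
  then show "coeff B 0 dvd 1"
    using unit_z p_gt_0 by (simp add: coeff_B is_unit_mult_iff)
qed (rule p_eq odd_p)+

lemma f_equiv_F: "f \<sim>\<^sub>Q fract_poly F"
proof (rule quot_equiv_scale[OF degree_f _ p_gt_0])
  show "to_fract U \<noteq> 0" using unit_U by auto
  show "coeff (fract_poly F) i = to_fract U ^ (p - i) * coeff f i" if "i \<le> p" for i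
  proof (cases "i = p")
    case False
    then show ?thesis
      using that by (simp add: coeff_map_poly F_def polyX_power of_nat_poly coeff_B coeff_f to_fract_power)
  qed (simp add: coeff_map_poly coeff_F_ge monic_f)
qed (simp add: degree_fract_poly degree_F)

lemma equiv_trinomial_if_root:
  assumes "l < p" "F dvd pcompose (polyX ^ p + P * ([:c:] * polyX ^ l) + P * [:d:]) R"
    "R - polyX \<in> I 2"
  shows "f \<sim>\<^sub>Q monom 1 p + monom (to_fract (of_nat p * c)) l + [:to_fract (of_nat p * d):]"
  using f_equiv_F quot_equiv_trinomial[OF assms] by (rule quot_equiv_trans)

lemma unit_iff: "x dvd 1 \<longleftrightarrow> \<not> of_nat p dvd x" for x :: "'p padic_int"
  unfolding p_eq by (rule padic_int_unit_iff)

lemma p_power_dvd_p_mult_iff: "of_nat p ^ Suc n dvd of_nat p * x \<longleftrightarrow> of_nat p ^ n dvd x"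
  for x :: "'p padic_int"
  using padic_p_nonzero[where 'p = 'p] unfolding p_eq by simp

lemma unit_if_cong: "x dvd 1 \<Longrightarrow> of_nat p dvd y - x \<Longrightarrow> y dvd 1" for x y :: "'p padic_int"
  using dvd_diff[of "of_nat p" y "y - x"] unfolding unit_iff by auto

text \<open>\<open>U\<close> inverts \<open>z 0\<close> modulo \<open>p\<close>, so the constant
  coefficient can be made \<open>p\<close>. For \<open>l = p - 1\<close> the congruence on
  \<open>t\<close> becomes \<open>e + (c + 1) * t = 0\<close> modulo \<open>p\<close>, solvable
  because \<open>c + 1\<close> is a unit.\<close>

lemma equiv_type_lambda:
  assumes l: "1 \<le> l" "l \<le> p - 1"
    and low: "\<And>i. 1 \<le> i \<Longrightarrow> i < l \<Longrightarrow> of_nat p dvd z i"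
    and zl: "z l dvd 1"
    and U: "U = of_nat m" "of_nat p dvd U * z 0 - 1"
    and c: "of_nat p dvd c - U ^ (p - l) * z l"
    and cond: "l \<noteq> p - 1 \<or> \<not> of_nat p dvd U ^ (p - l) * z l + 1"
  shows "f \<sim>\<^sub>Q monom 1 p + monom (to_fract (of_nat p * c)) l + [:to_fract (of_nat p * 1):]"
proof -
  have "U ^ (p - l) dvd 1" using dvd_power_same[OF unit_U, of "p - l"] by simp
  then have "U ^ (p - l) * z l dvd 1" using zl by (simp add: is_unit_mult_iff)
  then have unit_c: "c dvd 1" using c by (rule unit_if_cong)
  \<comment> \<open>As \<open>U\<close> is a natural number, Fermat gives \<open>U ^ p = U\<close>
    modulo \<open>p\<close>, so \<open>U ^ p * z 0\<close> is congruent to \<open>1\<close>.\<close>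
  have B0: "of_nat p dvd coeff B 0 - 1"
  proof -
    have "coeff B 0 - 1 = (U ^ p - U) * z 0 + (U * z 0 - 1)"
      using p_gt_0 by (simp add: coeff_B algebra_simps)
    then show ?thesis using of_nat_fermat[OF prime_p, of m] U by (metis dvd_add dvd_mult2)
  qed
  have "l < p" using l p_gt_0 by simp
  then have cB: "of_nat p dvd c - coeff B l" using c by (simp add: coeff_B)
  have low_B: "of_nat p dvd coeff B i" if "1 \<le> i" "i < l" for i
    using low[OF that] by (simp add: coeff_B)
  have B0': "of_nat p dvd 1 - coeff B 0" using dvd_minus_iff[of "of_nat p" "coeff B 0 - 1"] B0 by simp
  show ?thesis
  proof (cases "l = p - 1")
    case False
    then have "l + 2 \<le> p" using l by simp
    from root_lt_p_minus_1[OF l(1) this unit_c low_B cB B0'] obtain R where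
      "F dvd pcompose (polyX ^ p + P * ([:c:] * polyX ^ l) + P * [:1:]) R" "R - polyX \<in> I 2"
      by blast
    then show ?thesis using l p_gt_0 by (intro equiv_trinomial_if_root) auto
  next
    case True
    let ?D = "[:c:] * polyX ^ (p - 1) + [:1:] - B"
    have "of_nat p dvd coeff ?D i" for i
    proof -
      consider "i = 0" | "1 \<le> i" "i < l" | "i = l" | "i \<ge> p" using True by linarith
      then show ?thesis
        using B0' cB low_B[of i] l True p_gt_0
        by cases (auto simp: polyX_power coeff_pCons smult_monom coeff_B split: nat.splits)
    qed
    then have "P dvd ?D" unfolding of_nat_poly_dvd_iff by blast
    then obtain E where E: "?D = P * E" by (elim dvdE)
    have "of_nat p dvd (c + 1) - (U ^ (p - l) * z l + 1)" using c by simp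
    moreover have "U ^ (p - l) * z l + 1 dvd 1" using cond True by (simp add: unit_iff)
    ultimately have "c + 1 dvd 1" by (rule unit_if_cong[rotated])
    then obtain g where g: "1 = (c + 1) * g" by (elim dvdE)
    \<comment> \<open>The solution \<open>- e / (c + 1)\<close> is represented by a natural number,
      so that Fermat replaces \<open>t ^ p\<close> by \<open>t\<close>.\<close>
    obtain k :: nat where k: "of_nat p dvd - coeff E 0 * g - of_nat k"
      using padic_int_residue[of "- coeff E 0 * g"] unfolding p_eq by blast
    define t :: "'p padic_int" where "t = of_nat k"
    have "coeff E 0 + t ^ p * coeff B 0 ^ 2 + c * t * coeff B 0
        = coeff E 0 * (1 - (c + 1) * g) - (c + 1) * (- coeff E 0 * g - t) + (t ^ p - t) * coeff B 0 ^ 2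
          + t * (coeff B 0 + 1 + c) * (coeff B 0 - 1)"
      by (simp add: algebra_simps power2_eq_square)
    also have "of_nat p dvd \<dots>"
      using k B0 of_nat_fermat[OF prime_p, of k, where 'a = "'p padic_int"] g[symmetric]
      by (intro dvd_add dvd_diff) (simp_all add: t_def dvd_mult2)
    finally have "of_nat p dvd coeff E 0 + t ^ p * coeff B 0 ^ 2 + c * t * coeff B 0" .
    from root_p_minus_1[OF unit_c E this] obtain R where
      "F dvd pcompose (polyX ^ p + P * ([:c:] * polyX ^ (p - 1)) + P * [:1:]) R" "R - polyX \<in> I 2"
      by blast
    then show ?thesis using True p_gt_0 by (intro equiv_trinomial_if_root) auto
  qed
qed

text \<open>For \<open>c = - 1\<close> and normalized constant coefficient the congruence on
  \<open>t\<close> degenerates to \<open>e = 0\<close> modulo \<open>p\<close>. Matching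
  \<open>d\<close> modulo \<open>p ^ 2\<close> ensures this, and then \<open>t = 0\<close>
  works.\<close>

lemma equiv_type_p_minus_1:
  assumes low: "\<And>i. 1 \<le> i \<Longrightarrow> i < p - 1 \<Longrightarrow> of_nat p dvd z i"
    and z: "of_nat p dvd U * z (p - 1) + 1"
    and d: "of_nat p ^ 2 dvd d - U ^ p * z 0"
  shows "f \<sim>\<^sub>Q monom 1 p + monom (to_fract (of_nat p * (- 1))) (p - 1) + [:to_fract (of_nat p * d):]"
proof -
  let ?D = "[:- 1:] * polyX ^ (p - 1) + [:d:] - B"
  have D0: "coeff ?D 0 = d - U ^ p * z 0"
    using p_ge_3 by (simp add: polyX_power coeff_B smult_monom)
  have "of_nat p dvd coeff ?D i" for i
  proof -
    have low_B: "of_nat p dvd coeff B i" if "1 \<le> i" "i < p - 1"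
      using low[OF that] by (simp add: coeff_B)
    have "- 1 - U * z (p - 1) = - (U * z (p - 1) + 1)" by simp
    then have low2: "of_nat p dvd - 1 - U * z (p - 1)"
      using z by (simp only: dvd_minus_iff)
    have low3: "of_nat p dvd coeff ?D 0"
      unfolding D0 by (rule dvd_trans[OF _ d]) simp
    consider "i = 0" | "1 \<le> i" "i < p - 1" | "i = p - 1" | "i \<ge> p" by linarith
    then show ?thesis
      using low_B low2 low3 p_ge_3
      by cases (auto simp: polyX_power coeff_pCons smult_monom coeff_B split: nat.splits)
  qed
  then have "P dvd ?D" unfolding of_nat_poly_dvd_iff by blast
  then obtain E where E: "?D = P * E" by (elim dvdE)
  have "coeff ?D 0 = of_nat p * coeff E 0" unfolding E by (simp add: of_nat_poly)
  then have "of_nat p dvd coeff E 0"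
    using d D0 p_power_dvd_p_mult_iff[of 1 "coeff E 0"] by (simp add: numeral_2_eq_2)
  then have "of_nat p dvd coeff E 0 + 0 ^ p * coeff B 0 ^ 2 + (- 1) * 0 * coeff B 0"
    using p_gt_0 by (simp add: power_0_left)
  from root_p_minus_1[OF _ E this] obtain R where
    "F dvd pcompose (polyX ^ p + P * ([:- 1:] * polyX ^ (p - 1)) + P * [:d:]) R" "R - polyX \<in> I 2"
    by auto
  then show ?thesis using p_gt_0 by (intro equiv_trinomial_if_root) auto
qed

text \<open>The condition on \<open>y\<close> is \<open>y = - a_1 / (p a_0)\<close> for the scaled
  polynomial: the quotient of the two coefficients picks up a factor \<open>1 / U\<close>.\<close>

lemma equiv_type_0:
  assumes z: "\<And>i. 1 \<le> i \<Longrightarrow> i \<le> p - 1 \<Longrightarrow> of_nat p dvd z i"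
    and v: "z 1 = of_nat p * v"
    and y: "y * (U * z 0) = - v"
    and d: "of_nat p ^ 2 dvd d - (U ^ p * z 0 - of_nat p * y ^ p * (U ^ p * z 0) ^ 2)"
  shows "f \<sim>\<^sub>Q monom 1 p + [:to_fract (of_nat p * d):]"
proof -
  obtain U' where U': "polyX * U' = B - b0" by (rule B_split)
  have "of_nat p dvd coeff U' i" for i
  proof -
    have "coeff U' i = coeff (polyX * U') (Suc i)" by (simp add: polyX_mult)
    also have "\<dots> = coeff B (Suc i)" by (simp add: U' b0_def)
    finally show ?thesis using z[of "Suc i"] by (auto simp: coeff_B)
  qed
  then have "P dvd U'" unfolding of_nat_poly_dvd_iff by blast
  then obtain V where V: "U' = P * V" by (elim dvdE)
  have "of_nat p * coeff V 0 = coeff (polyX * U') 1"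
    by (simp add: polyX_mult V of_nat_poly)
  also have "\<dots> = of_nat p * (U ^ (p - 1) * v)"
    using p_ge_3 v by (simp add: U' b0_def coeff_B)
  finally have V0: "coeff V 0 = U ^ (p - 1) * v"
    using padic_p_nonzero[where 'p = 'p] unfolding p_eq by simp
  have "B = b0 + polyX * U'" by (simp add: U')
  then have BV: "B = b0 + P * (polyX * V)" by (simp add: V ac_simps)
  have "U ^ p = U ^ (p - 1) * U" using p_gt_0 by (simp flip: power_Suc2)
  then have "y * coeff B 0 = U ^ (p - 1) * (y * (U * z 0))"
    using p_gt_0 by (simp add: coeff_B)
  also have "\<dots> = - coeff V 0" by (simp add: y V0)
  finally have y': "y * coeff B 0 = - coeff V 0" .
  have "of_nat p ^ 2 dvd d - (coeff B 0 - of_nat p * y ^ p * coeff B 0 ^ 2)"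
    using d p_gt_0 by (simp add: coeff_B)
  from root_type_0[OF BV y' this] obtain R where
    R: "F dvd pcompose (polyX ^ p + P * [:d:]) R" "R - polyX \<in> I 2"
    by blast
  have "f \<sim>\<^sub>Q monom 1 p + monom (to_fract (of_nat p * 0)) 0 + [:to_fract (of_nat p * d):]"
    using R p_gt_0 by (intro equiv_trinomial_if_root[where R = R]) auto
  then show ?thesis by simp
qed

end

section \<open>Translation of the hypotheses and case distinction by type\<close>

theorem theorem1p16:
  fixes f :: "'p::prime_card padic poly"
    and p :: nat and a unit_part :: "nat \<Rightarrow> 'p padic" and s :: "nat \<Rightarrow> int"
    and u :: int and a0' a0'' :: "'p padic"
  assumes p: "p = CARD('p)" "odd p"
    and f: "eisenstein f"
    and a: "a = coeff f"
    and s: "\<And>i. a i \<noteq> 0 \<Longrightarrow> vp (a i) = ereal (of_int (s i))"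
    and unit_part: "\<And>i. a i \<noteq> 0 \<Longrightarrow> unit_part i = a i / of_nat p powi s i"
    and u: "u = residue 1 (inverse (unit_part 0))"
    and a0': "a0' = of_int u ^ p * a 0"
    and a0'': "a0'' = a 0 * (1 + (inverse (unit_part 0) * unit_part 1) ^ p * a 0)"
  shows
    "(\<forall>l. 1 \<le> l \<and> l \<le> p - 1 \<and> eisenstein_type f = l \<longrightarrow>
        (let u' = of_int u ^ (p - l) * unit_part l; a' = u' * of_nat p in
          (l \<noteq> p - 1 \<or> \<not> padic_cong 1 u' (-1) \<longrightarrow>
             f \<sim>\<^sub>Q monom 1 p + monom (of_int (residue 2 a')) l + [:of_nat p:]) \<and>
          (l = p - 1 \<and> padic_cong 1 u' (-1) \<longrightarrow>
             f \<sim>\<^sub>Q monom 1 p - monom (of_nat p) (p - 1) + [:of_int (residue 3 a0'):]))) \<and>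
     (eisenstein_type f = 0 \<longrightarrow>
        (vp (a 1) \<noteq> 2 \<longrightarrow> f \<sim>\<^sub>Q monom 1 p + [:of_int (residue 3 a0'):]) \<and>
        (vp (a 1) = 2 \<longrightarrow> f \<sim>\<^sub>Q monom 1 p + [:of_int (residue 3 a0''):]))"
proof -
  have p_gt_0: "p > 0" using p(2) by (cases p) auto
  have p_nz: "(of_nat p :: 'p padic_int) \<noteq> 0" unfolding p(1) by (rule padic_p_nonzero)
  have p_frac: "of_nat p = (to_fract (of_nat p) :: 'p padic)" by (rule of_nat_eq_to_fract)
  have unit_iff: "x dvd 1 \<longleftrightarrow> \<not> of_nat p dvd x" for x :: "'p padic_int"
    unfolding p(1) by (rule padic_int_unit_iff)
  have dvd_mult_iff: "of_nat p ^ Suc n dvd of_nat p * x \<longleftrightarrow> of_nat p ^ n dvd x"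
    for x :: "'p padic_int" and n
    using p_nz by simp
  have "\<exists>z. a i = to_fract (of_nat p * z)" if "i < p" for i
  proof -
    obtain x where x: "a i = to_fract x" using f by (auto simp: eisenstein_def a Zp_def)
    have "vp (to_fract x :: 'p padic) \<ge> ereal (real 1)"
      using f that by (simp add: eisenstein_def a p x[symmetric] one_ereal_def[symmetric])
    then show ?thesis
      unfolding vp_to_fract_ge_iff x by (auto simp: p elim: dvdE)
  qed
  then obtain z where z: "\<And>i. i < p \<Longrightarrow> a i = to_fract (of_nat p * z i)" by metis
  have vp_ge_2: "vp (a i) \<ge> 2 \<longleftrightarrow> of_nat p dvd z i" if "i < p" for i
    using vp_to_fract_ge_iff[of 2 "of_nat p * z i"] dvd_mult_iff[of 1 "z i"]
    by (simp add: z[OF that] p numeral_2_eq_2 del: to_fract_mult)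
  have vp_eq_1: "vp (a i) = 1 \<longleftrightarrow> z i dvd 1" if "i < p" for i
    using vp_to_fract_eq_iff[of "of_nat p * z i" 1] dvd_mult_iff[of 1 "z i"] p_nz
    by (simp add: z[OF that] p one_ereal_def[symmetric] unit_iff[unfolded p] del: to_fract_mult)
  have vp_eq_2: "vp (a 1) = 2 \<longleftrightarrow> of_nat p dvd z 1 \<and> \<not> of_nat p ^ 2 dvd z 1" if "1 < p"
    using vp_to_fract_eq_iff[of "of_nat p * z 1" 2] dvd_mult_iff[of 1 "z 1"] dvd_mult_iff[of 2 "z 1"]
      z[OF that] p_nz
    by (simp add: p numeral_2_eq_2 del: to_fract_mult)
  have z0: "z 0 dvd 1" using vp_eq_1[OF p_gt_0] f by (simp add: eisenstein_def a)
  have unit_part_eq: "unit_part i = to_fract w"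
    if "a i = to_fract (of_nat p ^ k * w)" "w dvd 1" for i k w
  proof -
    have nz: "a i \<noteq> 0" using that p_nz by auto
    have "vp (a i) = ereal (real k)" unfolding that(1) p(1) by (rule vp_to_fract[OF that(2)])
    then have "s i = int k" using s[OF nz] by simp
    then show ?thesis
      using unit_part[OF nz] p_nz by (simp add: that(1) p_frac to_fract_power)
  qed
  have up: "unit_part i = to_fract (z i)" if "i < p" "z i dvd 1" for i
    using unit_part_eq[of i 1 "z i"] that z by simp
  obtain z0' where z0': "1 = z 0 * z0'" using z0 by (elim dvdE)
  have inv: "inverse (unit_part 0) = to_fract z0'"
    using z0' unfolding up[OF p_gt_0 z0] by (metis inverse_unique to_fract_1 to_fract_mult)
  have unit_z0': "z0' dvd 1" using z0' by (metis dvd_triv_right)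
  define m where "m = nat u"
  define U :: "'p padic_int" where "U = of_nat m"
  have "\<not> of_nat CARD('p) ^ 1 dvd z0'" using unit_z0' unfolding padic_int_unit_iff by simp
  from residue_to_fract[OF this] have u1: "u \<ge> 1" and u2: "of_nat p dvd z0' - of_int u"
    unfolding u inv p by simp_all
  have U_int: "of_int u = U" using u1 by (simp add: U_def m_def)
  have U_frac: "of_int u = to_fract U" unfolding of_int_eq_to_fract U_int ..
  have Uz0: "of_nat p dvd U * z 0 - 1"
  proof -
    have eq: "U * z 0 - 1 = - ((z0' - U) * z 0)" using z0' by (simp add: algebra_simps)
    show ?thesis using u2 unfolding eq U_int dvd_minus_iff by (rule dvd_mult2)
  qed
  have unit_U: "U dvd 1"
    using unit_z0' u2 dvd_add[of "of_nat p" U "z0' - U"] unfolding unit_iff U_int by auto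
  have data: "scaled_eisenstein f z w p" if "w dvd 1" for w
    using p z z0 that f by unfold_locales (auto simp: eisenstein_def a)
  \<comment> \<open>Two scalings are used: by \<open>u\<close>, and the trivial one for type
    \<open>0\<close> with \<open>vp (a 1) = 2\<close>, where \<open>a0''\<close> is formed from the
    unscaled \<open>a 0\<close>.\<close>
  interpret S: scaled_eisenstein f z U p using data[OF unit_U] .
  interpret T: scaled_eisenstein f z 1 p by (rule data) simp
  have p3: "p \<ge> 3" by (rule S.p_ge_3)
  have unit_Upow: "U ^ n dvd 1" for n using dvd_power_same[OF unit_U, of n] by simp
  have a0'_eq: "a0' = to_fract (of_nat p * (U ^ p * z 0))"
    unfolding a0' U_frac z[OF p_gt_0] by (simp add: to_fract_power mult_ac)
  have res2: thesis if "b dvd 1"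
    "\<And>c. (of_int (residue 2 (to_fract (of_nat p * b))) :: 'p padic) = to_fract (of_nat p * c) \<Longrightarrow>
      of_nat p dvd c - b \<Longrightarrow> thesis" for b :: "'p padic_int" and thesis
    using residue_p_mult[of b 1] that unfolding of_int_eq_to_fract unit_iff p
    by (metis One_nat_def Suc_1 power_one_right zero_less_one)
  have res3: thesis if "b dvd 1"
    "\<And>c. (of_int (residue 3 (to_fract (of_nat p * b))) :: 'p padic) = to_fract (of_nat p * c) \<Longrightarrow>
      of_nat p ^ 2 dvd c - b \<Longrightarrow> thesis" for b :: "'p padic_int" and thesis
    using residue_p_mult[of b 2] that unfolding of_int_eq_to_fract unit_iff p
    by (metis numeral_3_eq_3 numeral_2_eq_2 zero_less_Suc)
  have unit_Uz: "U ^ p * z 0 dvd 1" using unit_Upow z0 by (simp add: is_unit_mult_iff)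
  let ?S = "{i \<in> {1..CARD('p) - 1}. vp (coeff f i) = 1}"
  have S_ne: "?S \<noteq> {}" if "\<not> (\<forall>i\<in>{1..CARD('p) - 1}. vp (coeff f i) \<ge> 2)"
  proof -
    obtain i where i: "i \<in> {1..CARD('p) - 1}" "\<not> vp (coeff f i) \<ge> 2"
      using \<open>\<not> (\<forall>i\<in>_. _)\<close> by blast
    then have "i < p" using p_gt_0 p by auto
    then have "vp (coeff f i) = 1" using i(2) vp_ge_2 vp_eq_1 unit_iff by (simp add: a)
    then show ?thesis using i(1) by blast
  qed
  have lam: "z l dvd 1 \<and> (\<forall>i. 1 \<le> i \<and> i < l \<longrightarrow> of_nat p dvd z i)"
    if l: "1 \<le> l" "l \<le> p - 1" "eisenstein_type f = l" for l
  proof -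
    have ne: "\<not> (\<forall>i\<in>{1..CARD('p) - 1}. vp (coeff f i) \<ge> 2)"
      using l by (auto simp: eisenstein_type_def split: if_splits)
    have lMin: "l = Min ?S"
      using l(3) unfolding eisenstein_type_def if_not_P[OF ne] by (rule sym)
    have fin: "finite ?S" by simp
    have "l \<in> ?S" unfolding lMin by (rule Min_in[OF fin S_ne[OF ne]])
    moreover have "l < p" using l p_gt_0 by simp
    ultimately have "z l dvd 1" using vp_eq_1 by (simp add: a)
    moreover have "of_nat p dvd z i" if "1 \<le> i" "i < l" for i
    proof (rule ccontr)
      assume "\<not> of_nat p dvd z i"
      then have "i \<in> ?S" using that \<open>l < p\<close> vp_eq_1[of i] unit_iff p by (auto simp: a)
      then have "l \<le> i" unfolding lMin by (rule Min_le[OF fin])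
      then show False using that by simp
    qed
    ultimately show ?thesis by blast
  qed
  have part1: "let u' = of_int u ^ (p - l) * unit_part l; a' = u' * of_nat p in
      (l \<noteq> p - 1 \<or> \<not> padic_cong 1 u' (-1) \<longrightarrow>
         f \<sim>\<^sub>Q monom 1 p + monom (of_int (residue 2 a')) l + [:of_nat p:]) \<and>
      (l = p - 1 \<and> padic_cong 1 u' (-1) \<longrightarrow>
         f \<sim>\<^sub>Q monom 1 p - monom (of_nat p) (p - 1) + [:of_int (residue 3 a0'):])"
    if l: "1 \<le> l" "l \<le> p - 1" "eisenstein_type f = l" for l
  proof -
    have zl: "z l dvd 1" and low: "\<And>i. 1 \<le> i \<Longrightarrow> i < l \<Longrightarrow> of_nat p dvd z i"
      using lam[OF l] by blast+
    have u': "of_int u ^ (p - l) * unit_part l = to_fract (U ^ (p - l) * z l)"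
      using up[OF _ zl] l p_gt_0 by (simp add: U_frac to_fract_power)
    have a': "to_fract (U ^ (p - l) * z l) * of_nat p = to_fract (of_nat p * (U ^ (p - l) * z l))"
      by (simp add: p_frac mult_ac)
    have cong: "padic_cong 1 (to_fract (U ^ (p - l) * z l)) (-1)
        \<longleftrightarrow> of_nat p dvd U ^ (p - l) * z l + 1"
      using padic_cong_to_fract[of 1 "U ^ (p - l) * z l" "- 1"] by (simp add: p)
    have "f \<sim>\<^sub>Q monom 1 p + monom (of_int (residue 2 (to_fract (of_nat p * (U ^ (p - l) * z l))))) l
        + [:of_nat p:]"
      if "l \<noteq> p - 1 \<or> \<not> of_nat p dvd U ^ (p - l) * z l + 1"
    proof -
      have "U ^ (p - l) * z l dvd 1" using unit_Upow zl by (simp add: is_unit_mult_iff)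
      then obtain c where c:
        "(of_int (residue 2 (to_fract (of_nat p * (U ^ (p - l) * z l)))) :: 'p padic)
          = to_fract (of_nat p * c)"
        "of_nat p dvd c - U ^ (p - l) * z l"
        by (rule res2)
      show ?thesis
        using S.equiv_type_lambda[OF l(1,2) low zl U_def Uz0 c(2) that]
        unfolding c(1) p_frac by simp
    qed
    moreover have "f \<sim>\<^sub>Q monom 1 p - monom (of_nat p) (p - 1) + [:of_int (residue 3 a0'):]"
      if "l = p - 1" "of_nat p dvd U ^ (p - l) * z l + 1"
    proof -
      obtain d where d: "(of_int (residue 3 a0') :: 'p padic) = to_fract (of_nat p * d)"
          "of_nat p ^ 2 dvd d - U ^ p * z 0"
        using res3[OF unit_Uz] unfolding a0'_eq by metis
      have "of_nat p dvd U * z (p - 1) + 1" using that p3 by simp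
      then have "f \<sim>\<^sub>Q monom 1 p + monom (to_fract (of_nat p * (- 1))) (p - 1)
          + [:to_fract (of_nat p * d):]"
        using low that(1) d(2) by (intro S.equiv_type_p_minus_1) auto
      then show ?thesis unfolding d(1) p_frac by (simp add: minus_monom[symmetric])
    qed
    ultimately show ?thesis unfolding Let_def u' a' cong by blast
  qed
  have part2: "(vp (a 1) \<noteq> 2 \<longrightarrow> f \<sim>\<^sub>Q monom 1 p + [:of_int (residue 3 a0'):]) \<and>
      (vp (a 1) = 2 \<longrightarrow> f \<sim>\<^sub>Q monom 1 p + [:of_int (residue 3 a0''):])"
    if type: "eisenstein_type f = 0"
  proof -
    have "\<forall>i\<in>{1..CARD('p) - 1}. vp (coeff f i) \<ge> 2"
    proof (rule ccontr)
      assume ne: "\<not> ?thesis"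
      have "Min ?S = 0" using type unfolding eisenstein_type_def if_not_P[OF ne] .
      moreover have "Min ?S \<in> ?S" by (rule Min_in[OF _ S_ne[OF ne]]) simp
      ultimately show False by auto
    qed
    then have zi: "of_nat p dvd z i" if "1 \<le> i" "i \<le> p - 1" for i
      using vp_ge_2[of i] that p3 p by (simp add: a)
    have "of_nat p dvd z 1" using zi[of 1] p3 by simp
    then obtain v where v: "z 1 = of_nat p * v" by (elim dvdE)
    have vp2: "vp (a 1) = 2 \<longleftrightarrow> v dvd 1"
      using vp_eq_2 p3 p_nz unfolding v by (simp add: unit_iff power2_eq_square)
    have "f \<sim>\<^sub>Q monom 1 p + [:of_int (residue 3 a0'):]" if "vp (a 1) \<noteq> 2"
    proof -
      obtain d where d: "(of_int (residue 3 a0') :: 'p padic) = to_fract (of_nat p * d)"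
          "of_nat p ^ 2 dvd d - U ^ p * z 0"
        using res3[OF unit_Uz] unfolding a0'_eq by metis
      have "U * z 0 dvd 1" using unit_U z0 by (simp add: is_unit_mult_iff)
      then obtain w where w: "1 = U * z 0 * w" by (elim dvdE)
      define y where "y = - v * w"
      have y: "y * (U * z 0) = - v" using w by (simp add: y_def mult_ac)
      \<comment> \<open>If \<open>vp (a 1)\<close> is not \<open>2\<close>, then \<open>p\<close>
        divides \<open>v\<close> and hence \<open>y\<close>, so the correction in
        \<open>equiv_type_0\<close> vanishes modulo \<open>p ^ 2\<close>.\<close>
      have "of_nat p dvd y" using that vp2 by (simp add: unit_iff y_def)
      then have "of_nat p dvd y ^ p" using p_gt_0 by (meson dvd_power dvd_trans)
      then have "of_nat p * of_nat p dvd of_nat p * y ^ p * (U ^ p * z 0) ^ 2"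
        by (intro dvd_mult2 mult_dvd_mono) auto
      then have "of_nat p ^ 2 dvd (d - U ^ p * z 0) + of_nat p * y ^ p * (U ^ p * z 0) ^ 2"
        using d(2) by (intro dvd_add) (simp_all add: power2_eq_square)
      then have "of_nat p ^ 2 dvd d - (U ^ p * z 0 - of_nat p * y ^ p * (U ^ p * z 0) ^ 2)"
        by (simp add: algebra_simps)
      from S.equiv_type_0[OF zi v y this] show ?thesis unfolding d(1) .
    qed
    moreover have "f \<sim>\<^sub>Q monom 1 p + [:of_int (residue 3 a0''):]" if "vp (a 1) = 2"
    proof -
      have unit_v: "v dvd 1" using that vp2 by simp
      have "unit_part 1 = to_fract v"
        using p3 unit_v by (intro unit_part_eq[of 1 2 v]) (simp_all only: z v power2_eq_square mult.assoc)
      then have a0''_eq: "a0'' = to_fract (of_nat p * (z 0 * (1 + (z0' * v) ^ p * (of_nat p * z 0))))"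
        unfolding a0'' inv z[OF p_gt_0] by (simp add: to_fract_power mult_ac)
      define y where "y = - v * z0'"
      have y: "y * (1 * z 0) = - v" using z0' by (simp add: y_def mult_ac)
      \<comment> \<open>Oddness of \<open>p\<close> turns the minus sign of the correction in
        \<open>equiv_type_0\<close> into the plus sign of \<open>a0''\<close>.\<close>
      have yp: "y ^ p = - ((z0' * v) ^ p)"
        using p(2) by (simp add: y_def power_minus_odd mult.commute)
      let ?b = "z 0 * (1 + (z0' * v) ^ p * (of_nat p * z 0))"
      have "of_nat p dvd ?b - z 0" by (simp add: algebra_simps)
      then have "?b dvd 1" using z0 by (rule S.unit_if_cong[rotated])
      then obtain d where d: "(of_int (residue 3 a0'') :: 'p padic) = to_fract (of_nat p * d)"
          "of_nat p ^ 2 dvd d - ?b"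
        using res3 unfolding a0''_eq by metis
      have "?b = 1 ^ p * z 0 - of_nat p * y ^ p * (1 ^ p * z 0) ^ 2"
        unfolding yp by (simp add: algebra_simps power2_eq_square)
      then have "of_nat p ^ 2 dvd d - (1 ^ p * z 0 - of_nat p * y ^ p * (1 ^ p * z 0) ^ 2)"
        using d(2) by simp
      from T.equiv_type_0[OF zi v y this] show ?thesis unfolding d(1) .
    qed
    ultimately show ?thesis by blast
  qed
  show ?thesis using part1 part2 by blast
qed

end
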